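(* Let $k \geq 3$ be an integer and let $n$ be a positive integer. The complete graph $K_n$ is the competition graph of some $k$-partite tournament if and only if \[ \begin{cases} n \geq 13 & \text{if } k=3;\\ n \geq 10 & \text{if } k=4;\\ n \geq 9 & \text{if } k\in\{5,6\};\\ n \geq k & \text{if } k\geq 7. \end{cases} \]
   Context: A $k$-partite tournament is an orientation of a finite complete $k$-partite graph (with $k$ nonempty partite sets), i.e. a digraph with no loops, no multiple arcs and no directed $2$-cycles whose underlying graph is that complete $k$-partite graph. The competition graph of a digraph $D$ is the graph with vertex set $V(D)$ in which two distinct vertices $u,v$ are adjacent if and only if they have a common out-neighbor in $D$, i.e. there is a vertex $w$ with $(u,w),(v,w)\in A(D)$. *)

theory Defs
  imports
    "Graph_Theory.Digraph_Component"
    "Graph_Theory.Kuratowski"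
    "HOL-Library.Disjoint_Sets"
begin

text \<open>
  Undirected graphs are symmetric digraphs, as in the library; \<^const>\<open>graph\<close> excludes loops and
  parallel arcs and requires finiteness. The blocks of a \<^const>\<open>partition_on\<close> are nonempty.
\<close>

definition complete_multipartite_digraph :: "nat \<Rightarrow> ('a, 'b) pre_digraph \<Rightarrow> bool" where
  "complete_multipartite_digraph k G \<longleftrightarrow> graph G \<and>
    (\<exists>P. partition_on (verts G) P \<and> card P = k \<and>
      arcs_ends G = {(u, v). (u, v) \<in> verts G \<times> verts G \<and> (\<nexists>X. X \<in> P \<and> u \<in> X \<and> v \<in> X)})"

definition multipartite_tournament :: "nat \<Rightarrow> ('a, 'b) pre_digraph \<Rightarrow> bool" where
  "multipartite_tournament k D \<longleftrightarrow> digraph D \<and>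
    (\<forall>u v. u \<rightarrow>\<^bsub>D\<^esub> v \<longrightarrow> \<not> v \<rightarrow>\<^bsub>D\<^esub> u) \<and>
    complete_multipartite_digraph k (with_proj (mk_symmetric D))"

definition competition_graph :: "('a, 'b) pre_digraph \<Rightarrow> 'a pair_pre_digraph" where
  "competition_graph D = \<lparr> pverts = verts D,
     parcs = {(u, v). u \<in> verts D \<and> v \<in> verts D \<and> u \<noteq> v \<and>
       (\<exists>w \<in> verts D. u \<rightarrow>\<^bsub>D\<^esub> w \<and> v \<rightarrow>\<^bsub>D\<^esub> w)} \<rparr>"

end

theory Submission
  imports Defs
begin

text \<open>
  \<^emph>\<open>Existence.\<close> Copying a vertex, or adding a source as a new part, preserves the property, so it
  suffices to exhibit tournaments for \<open>(k, n) = (3, 13), (4, 10), (5, 9), (6, 9), (7, 7)\<close>.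

  \<^emph>\<open>Lower bounds.\<close> A vertex \<open>u\<close> and any out-neighbour of \<open>u\<close> have a common out-neighbour, so the
  digraph induced on the out-neighbourhood of \<open>u\<close> has no sink. Hence all out-degrees are at least 3,
  with equality only if the out-neighbourhood is a directed triangle, and at least 4 if \<open>k = 3\<close>.
  Counting arcs against the part sizes leaves only few cases for \<open>n \<le> 9\<close>, with almost all
  out-degrees equal to 3. Moreover every vertex has an out-neighbour in the out-neighbourhood of
  \<open>u\<close>, so the in-degrees there have a large sum; as a large part or a large out-degree makes the
  in-degree small, this excludes most triangles and, in the end, all cases. For \<open>k = 3\<close> and
  \<open>n \<le> 12\<close> all parts have size 4 and all out-degrees are 4, and vertices of different parts have
  exactly one common out-neighbour. Then each part has two vertices with the same out-neighbours in
  exactly one of the other two parts, and this relation between parts is symmetric: impossible for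
  three parts.
\<close>

text \<open>The parts are the colour classes of \<open>c\<close>.\<close>

locale competing_tournament =
  fixes V :: "'a set" and R :: "'a \<Rightarrow> 'a \<Rightarrow> bool" and c :: "'a \<Rightarrow> 'c" and k :: nat
  assumes finite_V: "finite V"
    and arc_in_V: "R u v \<Longrightarrow> u \<in> V \<and> v \<in> V"
    and arc_asym: "R u v \<Longrightarrow> \<not> R v u"
    and arc_iff: "u \<in> V \<Longrightarrow> v \<in> V \<Longrightarrow> R u v \<or> R v u \<longleftrightarrow> c u \<noteq> c v"
    and card_parts: "card (c ` V) = k"
    and common_out: "u \<in> V \<Longrightarrow> v \<in> V \<Longrightarrow> u \<noteq> v \<Longrightarrow> \<exists>w. R u w \<and> R v w"

section \<open>Passing between digraphs and coloured arc relations\<close>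

lemma arc_mk_symmetric_iff:
  "(u, v) \<in> parcs (mk_symmetric (with_proj D)) \<longleftrightarrow> (u, v) \<in> parcs D \<or> (v, u) \<in> parcs D"
  by (simp add: parcs_mk_symmetric) (metis fst_conv snd_conv prod.collapse)

lemma multipartite_tournament_imp_competing:
  fixes D :: "'a pair_pre_digraph"
  assumes "multipartite_tournament k (with_proj D)"
    and "complete_digraph n (with_proj (competition_graph (with_proj D)))"
  shows "\<exists>(V :: 'a set) R (c :: 'a \<Rightarrow> 'a set set). competing_tournament V R c k \<and> card V = n"
proof -
  let ?V = "pverts D" and ?R = "\<lambda>u v. (u, v) \<in> parcs D"
  interpret digraph "with_proj D"
    using assms(1) by (simp add: multipartite_tournament_def)
  have comp: "finite ?V" "card ?V = n"
    "\<And>u v. u \<in> ?V \<Longrightarrow> v \<in> ?V \<Longrightarrow> u \<noteq> v \<Longrightarrow> \<exists>w. (u, w) \<in> parcs D \<and> (v, w) \<in> parcs D"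
    using assms(2) unfolding complete_digraph_pair_def
    by (auto simp: competition_graph_def set_eq_iff)
  have wf: "u \<in> ?V \<and> v \<in> ?V" if "(u, v) \<in> parcs D" for u v
    using wellformed[of "(u, v)"] that by simp
  have asym: "(v, u) \<notin> parcs D" if "(u, v) \<in> parcs D" for u v
    using assms(1) that by (auto simp: multipartite_tournament_def)
  obtain P where P: "partition_on ?V P" "card P = k"
    and arcs: "parcs (mk_symmetric (with_proj D)) =
      {(u, v). (u, v) \<in> ?V \<times> ?V \<and> (\<nexists>X. X \<in> P \<and> u \<in> X \<and> v \<in> X)}"
    using assms(1) by (auto simp: multipartite_tournament_def complete_multipartite_digraph_def)
  \<comment> \<open>The colour of a vertex is the singleton consisting of its block; a set of blocks
    as colour avoids choosing a block.\<close>
  let ?c = "\<lambda>u. {X \<in> P. u \<in> X}"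
  have unique: "X = Y" if "X \<in> P" "u \<in> X" "Y \<in> P" "u \<in> Y" for u X Y
    using P(1) that unfolding partition_on_def disjoint_def by blast
  then have block: "?c u = {X}" if "X \<in> P" "u \<in> X" for u X
    using that by blast
  have "competing_tournament ?V ?R ?c k"
  proof
    show "?R u v \<or> ?R v u \<longleftrightarrow> ?c u \<noteq> ?c v" if uv: "u \<in> ?V" "v \<in> ?V" for u v
    proof -
      obtain X Y where "X \<in> P" "u \<in> X" "Y \<in> P" "v \<in> Y"
        using P(1) uv unfolding partition_on_def by blast
      moreover have "X = Y \<longleftrightarrow> (\<exists>Z. Z \<in> P \<and> u \<in> Z \<and> v \<in> Z)"
        using calculation unique by blast
      ultimately have "?c u \<noteq> ?c v \<longleftrightarrow> (\<nexists>X. X \<in> P \<and> u \<in> X \<and> v \<in> X)"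
        by (simp add: block)
      then show ?thesis
        using arc_mk_symmetric_iff[of u v D] uv unfolding arcs by simp
    qed
    have "?c ` ?V = (\<lambda>X. {X}) ` P"
    proof (intro set_eqI iffI)
      fix Z assume "Z \<in> (\<lambda>X. {X}) ` P"
      then obtain X where "X \<in> P" "Z = {X}" by blast
      moreover obtain u where "u \<in> X"
        using P(1) \<open>X \<in> P\<close> unfolding partition_on_def by fastforce
      moreover have "u \<in> ?V"
        using P(1) \<open>X \<in> P\<close> \<open>u \<in> X\<close> unfolding partition_on_def by blast
      ultimately show "Z \<in> ?c ` ?V"
        using block[of X u] by (intro image_eqI) simp_all
    next
      fix Z assume "Z \<in> ?c ` ?V"
      then obtain u where "u \<in> ?V" "Z = ?c u" by blast
      moreover obtain X where "X \<in> P" "u \<in> X"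
        using P(1) \<open>u \<in> ?V\<close> unfolding partition_on_def by blast
      ultimately show "Z \<in> (\<lambda>X. {X}) ` P"
        using block by blast
    qed
    then show "card (?c ` ?V) = k"
      using P(2) by (simp add: card_image)
  qed (use comp wf asym in blast)+
  then show ?thesis
    using comp(2) by blast
qed

lemma competing_imp_multipartite_tournament:
  assumes "competing_tournament (V :: 'a set) R c k"
  shows "\<exists>D :: 'a pair_pre_digraph. multipartite_tournament k (with_proj D) \<and>
    complete_digraph (card V) (with_proj (competition_graph (with_proj D)))"
proof -
  interpret competing_tournament V R c k by fact
  define D where "D = \<lparr>pverts = V, parcs = {(u, v). R u v}\<rparr>"
  have D_simps [simp]: "pverts D = V" "(u, v) \<in> parcs D \<longleftrightarrow> R u v" for u v
    by (simp_all add: D_def)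
  have sub: "parcs D \<subseteq> V \<times> V"
    using arc_in_V by auto
  interpret pair_digraph D
  proof
    show "finite (parcs D)"
      using sub finite_V finite_subset by blast
    show "fst e \<noteq> snd e" if "e \<in> parcs D" for e
      using that arc_asym by (cases e) auto
  qed (use sub finite_V in auto)
  let ?S = "mk_symmetric (with_proj D)"
  let ?P = "(\<lambda>x. {v \<in> V. c v = x}) ` c ` V"
  have "pair_graph ?S"
    using pair_digraph.pair_digraph[OF digraph_mk_symmetric] symmetric_mk_symmetric
      by (auto simp: pair_graph_def pair_pseudo_graph_def pair_digraph_def pair_sym_digraph_def
        pair_sym_digraph_axioms_def pair_fin_digraph_def)
  then have graph: "graph (with_proj ?S)"
    by (rule pair_graph.pair_graphD_graph)
  have partition: "partition_on V ?P"
    by (auto simp: partition_on_def disjoint_def)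
  have card: "card ?P = k"
  proof -
    have "inj_on (\<lambda>x. {v \<in> V. c v = x}) (c ` V)"
      by (rule inj_onI) blast
    then show ?thesis
      using card_parts by (simp add: card_image)
  qed
  have arcs: "parcs ?S = {(u, v). (u, v) \<in> V \<times> V \<and> (\<nexists>X. X \<in> ?P \<and> u \<in> X \<and> v \<in> X)}"
  proof -
    have "(u, v) \<in> parcs ?S \<longleftrightarrow> R u v \<or> R v u" for u v
      by (simp add: arc_mk_symmetric_iff)
    then show ?thesis
      using arc_in_V arc_iff by (auto 0 4)
  qed
  have "complete_multipartite_digraph k (with_proj ?S)"
    unfolding complete_multipartite_digraph_def with_proj_simps pverts_mk_symmetric D_simps(1)
    by (intro conjI exI[of _ ?P] graph partition card arcs)
  then have tournament: "multipartite_tournament k (with_proj D)"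
    using arc_asym digraph_axioms by (simp add: multipartite_tournament_def)
  have "\<exists>w\<in>V. R u w \<and> R v w" if "u \<in> V" "v \<in> V" "u \<noteq> v" for u v
    using common_out[OF that] arc_in_V by blast
  then have "complete_digraph (card V) (with_proj (competition_graph (with_proj D)))"
    using finite_V by (auto simp: complete_digraph_pair_def competition_graph_def)
  with tournament show ?thesis by blast
qed

section \<open>Existence\<close>

text \<open>The new vertex \<open>y\<close> joins the part of \<open>x\<close> and dominates
  everything outside it, so its out-neighbourhood contains that of \<open>x\<close>. Hence it shares
  with any other \<open>u\<close> what \<open>x\<close> shares with \<open>u\<close>, and with
  \<open>x\<close> any out-neighbour of \<open>x\<close>, which exists because there are two
  vertices.\<close>

lemma competing_duplicate_vertex:
  assumes "competing_tournament V R (c :: 'a \<Rightarrow> 'c) k" and "x \<in> V" and "y \<notin> V" and "2 \<le> card V"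
  shows "\<exists>R' c'. competing_tournament (insert y V) R' (c' :: 'a \<Rightarrow> 'c) k"
proof -
  interpret competing_tournament V R "c :: 'a \<Rightarrow> 'c" k by fact
  define R' where "R' u v \<longleftrightarrow> R u v \<or> u = y \<and> v \<in> V \<and> c v \<noteq> c x" for u v
  define c' where "c' = c(y := c x)"
  have dominated: "\<exists>w. R' u w \<and> R' y w" if "u \<in> V" for u
  proof -
    obtain w where "R u w" "R x w"
    proof (cases "u = x")
      case True
      have "\<not> V \<subseteq> {x}"
        using assms(4) card_mono[of "{x}" V] by auto
      then show ?thesis
        using common_out[OF \<open>x \<in> V\<close>] True that by blast
    qed (use common_out[OF \<open>u \<in> V\<close> \<open>x \<in> V\<close>] that in blast)
    then have "R' u w" "R' y w"
      using arc_in_V arc_iff[of w x] by (auto simp: R'_def)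
    then show ?thesis by blast
  qed
  have "competing_tournament (insert y V) R' c' k"
  proof
    show "\<exists>w. R' u w \<and> R' v w" if "u \<in> insert y V" "v \<in> insert y V" "u \<noteq> v" for u v
      using that common_out[of u v] dominated[of u] dominated[of v] by (auto simp: R'_def)
    have "c' ` insert y V = c ` V"
      using \<open>x \<in> V\<close> \<open>y \<notin> V\<close> by (auto simp: c'_def)
    then show "card (c' ` insert y V) = k"
      using card_parts by simp
    show "R' u v \<or> R' v u \<longleftrightarrow> c' u \<noteq> c' v" if "u \<in> insert y V" "v \<in> insert y V" for u v
      using that arc_iff[of u v] arc_in_V \<open>y \<notin> V\<close> by (auto simp: R'_def c'_def)
    show "\<not> R' v u" if "R' u v" for u v
      using that arc_in_V arc_asym \<open>y \<notin> V\<close> unfolding R'_def by blast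
    show "u \<in> insert y V \<and> v \<in> insert y V" if "R' u v" for u v
      using that arc_in_V unfolding R'_def by blast
  qed (use finite_V in simp)
  then show ?thesis by blast
qed

text \<open>A source forming a part of its own dominates all of \<open>V\<close>, so any
  out-neighbour of \<open>u\<close> is common to \<open>u\<close> and the source. Natural numbers as
  colours guarantee a fresh one.\<close>

lemma competing_add_source:
  assumes "competing_tournament V R (c :: 'a \<Rightarrow> nat) k" and "y \<notin> V" and "2 \<le> card V"
  shows "\<exists>R' c'. competing_tournament (insert y V) R' (c' :: 'a \<Rightarrow> nat) (Suc k)"
proof -
  interpret competing_tournament V R "c :: 'a \<Rightarrow> nat" k by fact
  define R' where "R' u v \<longleftrightarrow> R u v \<or> u = y \<and> v \<in> V" for u v
  obtain z where "z \<notin> c ` V"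
    using finite_V ex_new_if_finite[OF infinite_UNIV_nat, of "c ` V"] by blast
  define c' where "c' = c(y := z)"
  have dominated: "\<exists>w. R' u w \<and> R' y w" if "u \<in> V" for u
  proof -
    have "\<not> V \<subseteq> {u}"
      using assms(3) card_mono[of "{u}" V] by auto
    then obtain w where "R u w"
      using common_out[OF \<open>u \<in> V\<close>] by blast
    then show ?thesis
      using arc_in_V unfolding R'_def by blast
  qed
  have "competing_tournament (insert y V) R' c' (Suc k)"
  proof
    show "\<exists>w. R' u w \<and> R' v w" if "u \<in> insert y V" "v \<in> insert y V" "u \<noteq> v" for u v
      using that common_out[of u v] dominated[of u] dominated[of v] by (auto simp: R'_def)
    have "c' ` insert y V = insert z (c ` V)"
      using \<open>y \<notin> V\<close> by (auto simp: c'_def)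
    then show "card (c' ` insert y V) = Suc k"
      using card_parts \<open>z \<notin> c ` V\<close> finite_V by simp
    show "R' u v \<or> R' v u \<longleftrightarrow> c' u \<noteq> c' v" if "u \<in> insert y V" "v \<in> insert y V" for u v
      using that arc_iff[of u v] arc_in_V \<open>y \<notin> V\<close> \<open>z \<notin> c ` V\<close> by (auto simp: R'_def c'_def)
    show "\<not> R' v u" if "R' u v" for u v
      using that arc_in_V arc_asym \<open>y \<notin> V\<close> unfolding R'_def by blast
    show "u \<in> insert y V \<and> v \<in> insert y V" if "R' u v" for u v
      using that arc_in_V unfolding R'_def by blast
  qed (use finite_V in simp)
  then show ?thesis by blast
qed

text \<open>Vertices and colours are both fixed to natural numbers, so that the two extension steps
  can be iterated with fresh elements.\<close>

definition realizable :: "nat \<Rightarrow> nat \<Rightarrow> bool" where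
  "realizable k n \<longleftrightarrow> (\<exists>(V :: nat set) R (c :: nat \<Rightarrow> nat). competing_tournament V R c k \<and> card V = n)"

lemma realizable_Suc_vertex:
  assumes "realizable k n" "2 \<le> n"
  shows "realizable k (Suc n)"
proof -
  obtain V :: "nat set" and R and c :: "nat \<Rightarrow> nat"
    where V: "competing_tournament V R c k" "card V = n"
    using assms(1) unfolding realizable_def by blast
  then have fin: "finite V"
    by (simp add: competing_tournament_def)
  obtain x where "x \<in> V"
    using V assms(2) by fastforce
  obtain y where "y \<notin> V"
    using fin ex_new_if_finite[OF infinite_UNIV_nat] by blast
  then obtain R' and c' :: "nat \<Rightarrow> nat" where "competing_tournament (insert y V) R' c' k"
    using competing_duplicate_vertex[OF V(1) \<open>x \<in> V\<close>] V(2) assms(2) by blast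
  moreover have "card (insert y V) = Suc n"
    using fin V(2) \<open>y \<notin> V\<close> by simp
  ultimately show ?thesis
    unfolding realizable_def by blast
qed

lemma realizable_Suc_part:
  assumes "realizable k n" "2 \<le> n"
  shows "realizable (Suc k) (Suc n)"
proof -
  obtain V :: "nat set" and R and c :: "nat \<Rightarrow> nat"
    where V: "competing_tournament V R c k" "card V = n"
    using assms(1) unfolding realizable_def by blast
  then have fin: "finite V"
    by (simp add: competing_tournament_def)
  obtain y where "y \<notin> V"
    using fin ex_new_if_finite[OF infinite_UNIV_nat] by blast
  then obtain R' and c' :: "nat \<Rightarrow> nat" where "competing_tournament (insert y V) R' c' (Suc k)"
    using competing_add_source[OF V(1)] V(2) assms(2) by blast
  moreover have "card (insert y V) = Suc n"
    using fin V(2) \<open>y \<notin> V\<close> by simp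
  ultimately show ?thesis
    unfolding realizable_def by blast
qed

lemma realizable_mono:
  assumes "realizable k m" "2 \<le> m" "m \<le> n"
  shows "realizable k n"
  using assms(3) assms(1,2)
  by (induction rule: dec_induct) (auto intro: realizable_Suc_vertex)

lemma realizable_add_parts:
  assumes "realizable k m" "2 \<le> m"
  shows "realizable (k + j) (m + j)"
  using assms by (induction j) (auto intro: realizable_Suc_part)

text \<open>Row \<open>u\<close> of a table lists the out-neighbours of \<open>u\<close>; the large tables come from a SAT solver.\<close>

definition valid_table :: "nat list list \<Rightarrow> (nat \<Rightarrow> nat) \<Rightarrow> nat \<Rightarrow> bool" where
  "valid_table T c k \<longleftrightarrow>
    (\<forall>u\<in>set [0..<length T]. \<forall>v\<in>set [0..<length T].
      (v \<in> set (T ! u) \<longrightarrow> u \<notin> set (T ! v)) \<and>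
      (v \<in> set (T ! u) \<or> u \<in> set (T ! v) \<longleftrightarrow> c u \<noteq> c v) \<and>
      (u \<noteq> v \<longrightarrow> (\<exists>w\<in>set (T ! u). w \<in> set (T ! v)))) \<and>
    (\<forall>xs\<in>set T. \<forall>v\<in>set xs. v < length T) \<and>
    length (remdups (map c [0..<length T])) = k"

lemma realizable_table:
  assumes "valid_table T c k" and "length T = n"
  shows "realizable k n"
proof -
  let ?R = "\<lambda>u v. u < length T \<and> v \<in> set (T ! u)"
  have T: "v \<in> set (T ! u) \<Longrightarrow> u \<notin> set (T ! v)"
    "v \<in> set (T ! u) \<or> u \<in> set (T ! v) \<longleftrightarrow> c u \<noteq> c v"
    "u \<noteq> v \<Longrightarrow> \<exists>w. w \<in> set (T ! u) \<and> w \<in> set (T ! v)"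
    if "u < length T" "v < length T" for u v
    using assms(1) that unfolding valid_table_def by (simp_all add: Ball_def Bex_def)
  have bound: "v < length T" if "u < length T" "v \<in> set (T ! u)" for u v
    using assms that nth_mem[of u T] unfolding valid_table_def by blast
  have "competing_tournament {..<length T} ?R c k"
  proof
    show "card (c ` {..<length T}) = k"
      using assms(1) by (simp add: valid_table_def length_remdups_card_conv atLeast0LessThan)
    show "\<exists>w. ?R u w \<and> ?R v w" if "u \<in> {..<length T}" "v \<in> {..<length T}" "u \<noteq> v" for u v
      using T(3)[of u v] that by simp
    show "?R u v \<or> ?R v u \<longleftrightarrow> c u \<noteq> c v" if "u \<in> {..<length T}" "v \<in> {..<length T}" for u v
      using T(2)[of u v] that by simp
    show "\<not> ?R v u" if "?R u v" for u v
      using T(1)[of u v] bound[of u v] that by simp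
    show "u \<in> {..<length T} \<and> v \<in> {..<length T}" if "?R u v" for u v
      using bound[of u v] that by simp
  qed simp
  moreover have "card {..<length T} = n"
    using assms(2) by simp
  ultimately show ?thesis
    unfolding realizable_def by blast
qed

section \<open>Smallest examples with three to seven parts\<close>

lemma realizable_3_13: "realizable 3 13"
proof -
  have "valid_table
    [[2, 4, 8, 10], [0, 3, 8, 9, 11], [1, 3, 4, 6], [4, 5, 7, 8], [6, 8, 11, 12], [0, 1, 4, 9,
    12], [1, 5, 10, 11], [0, 2, 5, 6], [6, 7, 9, 10], [2, 4, 7, 11], [2, 3, 5, 9, 12], [0, 3,
    7, 10, 12], [1, 2, 7, 8]]
    (\<lambda>v. v mod 3) 3"
    by code_simp
  then show ?thesis by (rule realizable_table) simp
qed

lemma realizable_4_10: "realizable 4 10"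
proof -
  \<comment> \<open>Part sizes 4, 2, 2, 2: the vertices 0 to 3 form one part, the others are
    paired.\<close>
  have "valid_table
    [[5, 7, 9], [4, 7, 8], [5, 6, 8], [4, 6, 9], [0, 2, 8, 9], [1, 3, 8, 9], [0, 1, 4, 5], [2,
    3, 4, 5], [0, 3, 6, 7], [1, 2, 6, 7]]
    (\<lambda>v. if v < 4 then 0 else v div 2) 4"
    by code_simp
  then show ?thesis by (rule realizable_table) simp
qed

lemma realizable_5_9: "realizable 5 9"
proof -
  have "valid_table
    [[3, 4, 7], [0, 5, 7, 8], [0, 1, 3, 8], [1, 4, 5], [1, 2, 6, 7], [2, 4, 8], [0, 2, 3, 5],
    [3, 5, 6, 8], [0, 4, 6]]
    (\<lambda>v. v mod 5) 5"
    by code_simp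
  then show ?thesis by (rule realizable_table) simp
qed

lemma realizable_6_9: "realizable 6 9"
proof -
  have "valid_table
    [[2, 5, 7, 8], [0, 3, 5], [1, 4, 5], [0, 2, 4], [0, 1, 6, 7], [3, 4, 6, 8], [1, 2, 3], [2,
    3, 5, 6], [1, 3, 4, 6, 7]]
    (\<lambda>v. v mod 6) 6"
    by code_simp
  then show ?thesis by (rule realizable_table) simp
qed

text \<open>The rows are the translates of the quadratic residues 1, 2, 4 modulo 7: this is the
  Paley tournament, and its out-neighbourhoods are the lines of the Fano plane, any two of which
  meet.\<close>

lemma realizable_7_7: "realizable 7 7"
proof -
  have "valid_table
    [[1, 2, 4], [2, 3, 5], [3, 4, 6], [0, 4, 5], [1, 5, 6], [0, 2, 6], [0, 1, 3]]
    (\<lambda>v. v) 7"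
    by code_simp
  then show ?thesis by (rule realizable_table) simp
qed

lemma realizable_if_large:
  assumes "3 \<le> k"
    and "if k = 3 then n \<ge> 13 else if k = 4 then n \<ge> 10 else if k \<in> {5, 6} then n \<ge> 9 else n \<ge> k"
  shows "realizable k n"
proof -
  consider "k = 3" "13 \<le> n" | "k = 4" "10 \<le> n" | "k = 5" "9 \<le> n" | "k = 6" "9 \<le> n" | "7 \<le> k" "k \<le> n"
    using assms by (cases "k = 3"; cases "k = 4"; cases "k = 5"; cases "k = 6") auto
  then show ?thesis
  proof cases
    case 1
    then show ?thesis
      using realizable_mono[OF realizable_3_13] by simp
  next
    case 2
    then show ?thesis
      using realizable_mono[OF realizable_4_10] by simp
  next
    case 3
    then show ?thesis
      using realizable_mono[OF realizable_5_9] by simp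
  next
    case 4
    then show ?thesis
      using realizable_mono[OF realizable_6_9] by simp
  next
    case 5
    have "realizable k k"
      using realizable_add_parts[OF realizable_7_7, of "k - 7"] 5 by simp
    then show ?thesis
      using realizable_mono 5 by simp
  qed
qed

section \<open>Degrees and part sizes\<close>

text \<open>Written out, the identities of \<open>part_sizes\<close> become linear constraints on
  the single values of \<open>q\<close>.\<close>

lemma sum_1_7: "(\<Sum>j=1..7. f j) = (f 1 + f 2 + f 3 + f 4 + f 5 + f 6 + f 7 :: nat)"
  for f :: "nat \<Rightarrow> nat"
proof -
  have "{1..7::nat} = {1, 2, 3, 4, 5, 6, 7}"
    by auto
  then show ?thesis
    by simp
qed

lemma sum_1_8: "(\<Sum>j=1..8. f j) = (f 1 + f 2 + f 3 + f 4 + f 5 + f 6 + f 7 + f 8 :: nat)"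
  for f :: "nat \<Rightarrow> nat"
proof -
  have "{1..8::nat} = {1, 2, 3, 4, 5, 6, 7, 8}"
    by auto
  then show ?thesis
    by simp
qed

lemma sum_1_9: "(\<Sum>j=1..9. f j) = (f 1 + f 2 + f 3 + f 4 + f 5 + f 6 + f 7 + f 8 + f 9 :: nat)"
  for f :: "nat \<Rightarrow> nat"
proof -
  have "{1..9::nat} = {1, 2, 3, 4, 5, 6, 7, 8, 9}"
    by auto
  then show ?thesis
    by simp
qed

text \<open>Two steps inside \<open>X\<close> visit three different vertices, since asymmetry rules
  out loops and going back. Applied to out-neighbourhoods and to in-neighbourhoods.\<close>

lemma card_ge_3_if_out_step:
  assumes "finite X" "X \<noteq> {}"
    and asym: "\<And>x y. R x y \<Longrightarrow> \<not> R y x"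
    and step: "\<And>x. x \<in> X \<Longrightarrow> \<exists>y\<in>X. R x y"
  shows "\<exists>x y z. {x, y, z} \<subseteq> X \<and> R x y \<and> R y z \<and> x \<noteq> y \<and> y \<noteq> z \<and> x \<noteq> z"
    and "3 \<le> card X"
proof -
  obtain x where "x \<in> X" using assms(2) by blast
  moreover obtain y where "y \<in> X" "R x y" using step calculation by blast
  moreover obtain z where "z \<in> X" "R y z" using step calculation by blast
  ultimately show *: "\<exists>x y z. {x, y, z} \<subseteq> X \<and> R x y \<and> R y z \<and> x \<noteq> y \<and> y \<noteq> z \<and> x \<noteq> z"
    using asym by blast
  then obtain x y z where "{x, y, z} \<subseteq> X" "x \<noteq> y" "y \<noteq> z" "x \<noteq> z"
    by blast
  then show "3 \<le> card X"
    using card_mono[of X "{x, y, z}"] assms(1) by simp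
qed

context competing_tournament
begin

definition N :: "'a \<Rightarrow> 'a set" where "N u = {w. R u w}"
definition I :: "'a \<Rightarrow> 'a set" where "I w = {u. R u w}"
definition d :: "'a \<Rightarrow> nat" where "d u = card (N u)"
definition P :: "'c \<Rightarrow> 'a set" where "P i = {v \<in> V. c v = i}"
text \<open>Attached to vertices instead of parts: then \<open>degree_sum\<close> is an identity at
  each vertex, and the sum of \<open>sz\<close> over \<open>V\<close> is the sum of the squares of
  the part sizes.\<close>

definition sz :: "'a \<Rightarrow> nat" where "sz u = card (P (c u))"

lemma mem_N [simp]: "w \<in> N u \<longleftrightarrow> R u w" and mem_I [simp]: "u \<in> I w \<longleftrightarrow> R u w"
  by (simp_all add: N_def I_def)

lemma mem_P [simp]: "v \<in> P i \<longleftrightarrow> v \<in> V \<and> c v = i"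
  by (simp add: P_def)

lemma N_sub: "N u \<subseteq> V" and I_sub: "I u \<subseteq> V" and P_sub: "P i \<subseteq> V"
  using arc_in_V by auto

lemma finite_N [simp]: "finite (N u)" and finite_I [simp]: "finite (I u)"
    and finite_P [simp]: "finite (P i)"
  by (rule finite_subset[OF N_sub finite_V] finite_subset[OF I_sub finite_V]
      finite_subset[OF P_sub finite_V])+

lemma arc_irrefl: "\<not> R u u"
  using arc_asym by blast

lemma arc_color: "R u v \<Longrightarrow> c u \<noteq> c v"
  using arc_in_V arc_iff by blast

lemma sz_pos: "v \<in> V \<Longrightarrow> 1 \<le> sz v"
  by (auto simp: sz_def Suc_le_eq card_gt_0_iff)

lemma degree_sum: "u \<in> V \<Longrightarrow> d u + card (I u) + sz u = card V"
proof -
  assume "u \<in> V"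
  then have "R u x \<or> R x u \<or> x \<in> P (c u)" if "x \<in> V" for x
    using arc_iff[OF _ that, of u] that by auto
  then have "V = N u \<union> (I u \<union> P (c u))"
    using N_sub[of u] I_sub[of u] P_sub[of "c u"] unfolding N_def I_def by blast
  moreover have disj: "N u \<inter> (I u \<union> P (c u)) = {}" "I u \<inter> P (c u) = {}"
    unfolding disjoint_iff using arc_asym arc_color by (metis Un_iff mem_I mem_N mem_P)+
  ultimately show ?thesis
    using card_Un_disjoint[OF _ _ disj(1)] card_Un_disjoint[OF _ _ disj(2)]
    unfolding d_def sz_def by simp
qed

text \<open>Both sides count the arcs from \<open>A\<close> to \<open>B\<close>, once by tail and
  once by head.\<close>

lemma arc_count:
  assumes "finite A" "finite B"
  shows "(\<Sum>u\<in>A. card (N u \<inter> B)) = (\<Sum>w\<in>B. card (I w \<inter> A))"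
proof -
  have "(\<Sum>u\<in>A. card (N u \<inter> B)) = (\<Sum>u\<in>A. \<Sum>w\<in>B. of_bool (R u w))"
    using assms by (intro sum.cong) (auto simp: Int_def conj_commute intro!: arg_cong[of _ _ card])
  also have "\<dots> = (\<Sum>w\<in>B. \<Sum>u\<in>A. of_bool (R u w))"
    by (rule sum.swap)
  also have "\<dots> = (\<Sum>w\<in>B. card (I w \<inter> A))"
    using assms by (intro sum.cong) (auto simp: Int_def conj_commute intro!: arg_cong[of _ _ card])
  finally show ?thesis .
qed

lemma sum_d: "(\<Sum>u\<in>V. d u) = (\<Sum>u\<in>V. card (I u))"
  using arc_count[OF finite_V finite_V] N_sub I_sub by (simp add: d_def Int_absorb2)

lemma sum_d_sz: "2 * (\<Sum>u\<in>V. d u) + (\<Sum>u\<in>V. sz u) = card V * card V"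
proof -
  have "(\<Sum>u\<in>V. d u + card (I u) + sz u) = card V * card V"
    by (simp add: degree_sum)
  then show ?thesis
    using sum_d by (simp add: sum.distrib)
qed

text \<open>The common out-neighbour of \<open>u\<close> and \<open>w\<close> is itself in
  \<open>N u\<close>. So no vertex of \<open>N u\<close> is a sink there, which is the origin of all
  lower bounds on out-degrees.\<close>

lemma out_step:
  assumes "R u w" shows "\<exists>x\<in>N u. R w x"
  using common_out[of u w] assms arc_in_V arc_irrefl unfolding N_def by blast

lemma codegree_sum: "(\<Sum>w\<in>N u. card (I w)) = (\<Sum>v\<in>V. card (N u \<inter> N v))"
  using arc_count[OF finite_V finite_N, of u] I_sub by (simp add: Int_absorb1 Int_commute)

lemma codegree_pos:
  assumes "u \<in> V" "v \<in> V" "u \<noteq> v"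
  shows "1 \<le> card (N u \<inter> N v)"
  using common_out[OF assms] by (auto simp: Suc_le_eq card_gt_0_iff)

lemma codegree_sum_minus:
  assumes "u \<in> V"
  shows "(\<Sum>w\<in>N u. card (I w)) = d u + (\<Sum>v\<in>V - {u}. card (N u \<inter> N v))"
  using assms finite_V by (simp add: codegree_sum d_def sum.remove[of V u])

text \<open>Every vertex other than \<open>u\<close> has an out-neighbour in \<open>N u\<close>, which bounds the in-degrees on
  \<open>N u\<close> from below, that is, \<open>d + sz\<close> from above.\<close>

lemma N_weight:
  assumes "u \<in> V"
  shows "(\<Sum>w\<in>N u. d w + sz w) + card V + d u \<le> d u * card V + 1"
proof -
  have "card (V - {u}) \<le> (\<Sum>v\<in>V - {u}. card (N u \<inter> N v))"
    using sum_mono[of "V - {u}" "\<lambda>_. 1" "\<lambda>v. card (N u \<inter> N v)"] codegree_pos assms by auto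
  moreover have "(\<Sum>w\<in>N u. card (I w)) + (\<Sum>w\<in>N u. d w + sz w) = (\<Sum>w\<in>N u. card V)"
    unfolding sum.distrib[symmetric] using degree_sum N_sub by (intro sum.cong) (force+)
  ultimately show ?thesis
    using codegree_sum_minus[OF assms] assms finite_V by (simp add: d_def)
qed

text \<open>Counting the parts by size turns the case distinctions on part sizes into linear arithmetic.\<close>

lemma part_sizes:
  obtains q :: "nat \<Rightarrow> nat" where "(\<Sum>j=1..card V. q j) = k"
    and "\<And>j. card {v \<in> V. sz v = j} = j * q j"
    and "(\<Sum>j=1..card V. j * q j) = card V"
    and "(\<Sum>j=1..card V. j * j * q j) = (\<Sum>v\<in>V. sz v)"
proof -
  define q where "q j = card {i \<in> c ` V. card (P i) = j}" for j
  \<comment> \<open>No part is empty or larger than \<open>V\<close>, so grouping by sizes in this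
    range misses none.\<close>
  have range: "card (P i) \<in> {1..card V}" if "i \<in> c ` V" for i
    using that card_mono[OF finite_V P_sub[of i]] by (auto simp: Suc_le_eq card_gt_0_iff)
  then have range': "sz v \<in> {1..card V}" if "v \<in> V" for v
    using that by (auto simp: sz_def)
  have card_sz: "card {v \<in> V. sz v = j} = j * q j" for j
  proof -
    have "{v \<in> V. sz v = j} = (\<Union>i\<in>{i \<in> c ` V. card (P i) = j}. P i)"
      by (auto simp: sz_def)
    also have "card \<dots> = (\<Sum>i\<in>{i \<in> c ` V. card (P i) = j}. card (P i))"
      using finite_V by (intro card_UN_disjoint) auto
    also have "\<dots> = j * q j"
      by (simp add: q_def)
    finally show ?thesis .
  qed
  \<comment> \<open>The weights 1, \<open>j\<close> and \<open>j * j\<close> give the three sums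
    claimed.\<close>
  have by_size: "(\<Sum>j=1..card V. q j * f j) = (\<Sum>i\<in>c ` V. f (card (P i)))" for f
  proof -
    have "(\<Sum>j=1..card V. q j * f j) =
        (\<Sum>j=1..card V. \<Sum>i\<in>{i \<in> c ` V. card (P i) = j}. f (card (P i)))"
      by (intro sum.cong) (auto simp: q_def)
    also have "\<dots> = (\<Sum>i\<in>c ` V. f (card (P i)))"
      using range finite_V by (intro sum.group) auto
    finally show ?thesis .
  qed
  have by_vertex: "(\<Sum>i\<in>c ` V. card (P i) * f (card (P i))) = (\<Sum>v\<in>V. f (sz v))" for f
  proof -
    have "(\<Sum>i\<in>c ` V. card (P i) * f (card (P i))) = (\<Sum>i\<in>c ` V. \<Sum>v\<in>{v \<in> V. c v = i}. f (sz v))"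
      by (intro sum.cong) (auto simp: sz_def P_def)
    then show ?thesis
      using sum.group[of V "c ` V" c "\<lambda>v. f (sz v)"] finite_V by simp
  qed
  show thesis
  proof (rule that)
    show "(\<Sum>j=1..card V. q j) = k"
      using by_size[of "\<lambda>_. 1"] card_parts by simp
    show "(\<Sum>j=1..card V. j * q j) = card V"
      using by_size[of "\<lambda>j. j"] by_vertex[of "\<lambda>_. 1"] by (simp add: mult.commute)
    show "(\<Sum>j=1..card V. j * j * q j) = (\<Sum>v\<in>V. sz v)"
      using by_size[of "\<lambda>j. j * j"] by_vertex[of "\<lambda>j. j"] by (simp add: mult.commute)
  qed (rule card_sz)
qed

text \<open>All out-degrees are at least 3 if \<open>3 \<le> k\<close>, so the subtraction does not truncate there.\<close>

definition e :: "'a \<Rightarrow> nat" where "e u = d u - 3"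

lemma card_V_ge_k: "k \<le> card V"
  using card_image_le[OF finite_V, of c] card_parts by simp

lemma arcI: "u \<in> V \<Longrightarrow> v \<in> V \<Longrightarrow> c u \<noteq> c v \<Longrightarrow> \<not> R v u \<Longrightarrow> R u v"
  using arc_iff[of u v] by simp

end

section \<open>Minimum out-degree three and its equality case\<close>

locale competing_tournament_3 = competing_tournament +
  assumes k_ge_3: "3 \<le> k"
begin

lemma N_nonempty:
  assumes "u \<in> V" shows "N u \<noteq> {}"
proof -
  have "\<not> V \<subseteq> {u}"
    using card_V_ge_k k_ge_3 card_mono[of "{u}" V] by auto
  then show ?thesis
    using common_out[OF assms] unfolding N_def by blast
qed

lemma d_ge_3: "u \<in> V \<Longrightarrow> 3 \<le> d u"
  unfolding d_def
proof (rule card_ge_3_if_out_step(2)[of _ R])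
  show "\<exists>y\<in>N u. R x y" if "x \<in> N u" for x
    using that out_step by simp
  show "\<not> R y x" if "R x y" for x y
    using that by (rule arc_asym)
qed (use N_nonempty in simp_all)

lemma d_eq: "u \<in> V \<Longrightarrow> d u = 3 + e u"
  using d_ge_3[of u] by (simp add: e_def)

text \<open>\<open>sum_d_sz\<close> in terms of the excess over out-degree 3: for small
  \<open>card V\<close> it leaves little room for excess or for large parts.\<close>

lemma sum_e: "2 * (\<Sum>u\<in>V. e u) + 6 * card V + (\<Sum>u\<in>V. sz u) = card V * card V"
proof -
  have "(\<Sum>u\<in>V. d u) = (\<Sum>u\<in>V. 3 + e u)"
    using d_eq by (intro sum.cong) simp_all
  then show ?thesis
    using sum_d_sz by (simp add: sum.distrib)
qed

lemma sum_e_le: "A \<subseteq> V \<Longrightarrow> (\<Sum>u\<in>A. e u) \<le> (\<Sum>u\<in>V. e u)"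
  using finite_V by (intro sum_mono2) auto

lemma card_I: "w \<in> V \<Longrightarrow> card (I w) + 3 + e w + sz w = card V"
  using degree_sum[of w] d_eq[of w] by simp

text \<open>Three vertices without a sink: after \<open>w\<close>, \<open>x\<close>,
  \<open>y\<close> the next step from \<open>y\<close> can only return to \<open>w\<close>.\<close>

lemma N_cycle:
  assumes "e u = 0" "R u w"
  obtains x y where "N u = {w, x, y}" "R w x" "R x y" "R y w" "w \<noteq> x" "w \<noteq> y" "x \<noteq> y"
proof -
  have "card (N u) = 3"
    using assms d_eq arc_in_V by (simp add: d_def)
  obtain x y where xy: "x \<in> N u" "R w x" "y \<in> N u" "R x y"
    using out_step assms(2) mem_N by metis
  then have ne: "w \<noteq> x" "w \<noteq> y" "x \<noteq> y"
    using arc_asym by blast+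
  then have N: "{w, x, y} = N u"
    using xy assms(2) \<open>card (N u) = 3\<close> by (intro card_subset_eq) auto
  moreover obtain z where "z \<in> N u" "R y z"
    using out_step xy(3) mem_N by metis
  ultimately have "z = w \<or> z = x \<or> z = y"
    by blast
  then have "R y w"
    using \<open>R y z\<close> xy(4) arc_asym by metis
  then show thesis
    using that xy ne N by blast
qed

text \<open>\<open>N_weight\<close> at out-degree 3; with \<open>d = 3 + e\<close> on the triangle
  the constants combine to 9 + 3 - 1 = 11.\<close>

lemma N_cycle_weight:
  assumes "N u = {w, x, y}" "w \<noteq> x" "w \<noteq> y" "x \<noteq> y"
  shows "e w + sz w + e x + sz x + e y + sz y + 11 \<le> 2 * card V"
proof -
  have "u \<in> V" "w \<in> V" "x \<in> V" "y \<in> V"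
    using assms(1) arc_in_V unfolding N_def by blast+
  moreover have "d u = 3"
    using assms by (simp add: d_def)
  ultimately show ?thesis
    using N_weight[of u] assms d_eq by simp
qed

lemma sum_sz_ge: "card V \<le> (\<Sum>v\<in>V. sz v)"
  using sum_mono[of V "\<lambda>_. 1" sz] sz_pos by simp

lemma card_V_ge_7: "7 \<le> card V"
proof -
  have "7 * card V \<le> card V * card V"
    using sum_e sum_sz_ge by linarith
  then show ?thesis
    using card_V_ge_k k_ge_3 by simp
qed

text \<open>Equality case of the previous bound: the sum of squares of the part sizes is at most 7,
  so all parts are singletons.\<close>

lemma k_eq_7_if_card_7:
  assumes "card V = 7"
  shows "k = 7"
proof -
  obtain q where q: "(\<Sum>j=1..card V. q j) = k" "\<And>j. card {v \<in> V. sz v = j} = j * q j"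
    "(\<Sum>j=1..card V. j * q j) = card V" "(\<Sum>j=1..card V. j * j * q j) = (\<Sum>v\<in>V. sz v)"
    by (rule part_sizes) blast
  have "(\<Sum>v\<in>V. sz v) \<le> 7"
    using sum_e assms by simp
  then have "q 1 + q 2 + q 3 + q 4 + q 5 + q 6 + q 7 = k"
    "q 1 + 2 * q 2 + 3 * q 3 + 4 * q 4 + 5 * q 5 + 6 * q 6 + 7 * q 7 = 7"
    "q 1 + 4 * q 2 + 9 * q 3 + 16 * q 4 + 25 * q 5 + 36 * q 6 + 49 * q 7 \<le> 7"
    using q(1,3) q(4)[symmetric] unfolding assms sum_1_7 by simp_all
  then show ?thesis
    by linarith
qed

text \<open>Adjacent vertices lie in different parts, so there are two parts of size
  \<open>j\<close>. Used when too few vertices lie in parts of that size.\<close>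

lemma sz_add_le:
  assumes "R u v" "sz u = j" "sz v = j"
  shows "2 * j \<le> card {w \<in> V. sz w = j}"
proof -
  have "card (P (c u) \<union> P (c v)) = 2 * j"
    using assms arc_color[OF assms(1)] by (subst card_Un_disjoint) (auto simp: sz_def)
  moreover have sub: "P (c u) \<union> P (c v) \<subseteq> {w \<in> V. sz w = j}"
    using assms(2,3) by (auto simp: sz_def)
  ultimately show ?thesis
    using card_mono[of "{w \<in> V. sz w = j}", OF _ sub] finite_V by simp
qed

lemma sz_add_le_3:
  assumes "R u v" "R v w" "R w u" "sz u = j" "sz v = j" "sz w = j"
  shows "3 * j \<le> card {w \<in> V. sz w = j}"
proof -
  have "card (P (c u) \<union> (P (c v) \<union> P (c w))) = 3 * j"
    using assms arc_color[OF assms(1)] arc_color[OF assms(2)] arc_color[OF assms(3)]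
    by (subst card_Un_disjoint; (subst card_Un_disjoint)?) (auto simp: sz_def)
  moreover have sub: "P (c u) \<union> (P (c v) \<union> P (c w)) \<subseteq> {w \<in> V. sz w = j}"
    using assms(4-) by (auto simp: sz_def)
  ultimately show ?thesis
    using card_mono[of "{w \<in> V. sz w = j}", OF _ sub] finite_V by simp
qed

lemma singleton_arc:
  assumes "u \<in> V" "v \<in> V" "u \<noteq> v" "sz u = 1" "\<not> R v u"
  shows "R u v"
proof -
  obtain x where "P (c u) = {x}"
    using assms(4) card_1_singletonE unfolding sz_def by blast
  moreover have "u \<in> P (c u)" "c u = c v \<Longrightarrow> v \<in> P (c u)"
    using assms(1,2) by simp_all
  ultimately have "c u \<noteq> c v"
    using assms(3) by (metis singletonD)
  then show ?thesis
    using assms(1,2,5) by (intro arcI)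
qed

text \<open>The out-neighbourhood of \<open>u\<close> is a directed triangle through \<open>w\<close>; the witness is the vertex
  preceding \<open>w\<close> on it.\<close>

lemma in_step:
  assumes "R u w" "e u = 0"
  shows "\<exists>y\<in>I w. R u y"
proof -
  obtain x y where "N u = {w, x, y}" "R y w"
    by (rule N_cycle[OF assms(2,1)])
  then show ?thesis
    using mem_N[of y u] by (intro bexI[of _ y]) auto
qed

text \<open>By \<open>in_step\<close> the digraph on \<open>I w\<close> has no sink either, so the
  walk argument for out-neighbourhoods applies to it. Used against vertices of small
  in-degree.\<close>

lemma card_I_ge_3:
  assumes "R u w" "\<And>u. R u w \<Longrightarrow> e u = 0"
  shows "3 \<le> card (I w)"
proof (rule card_ge_3_if_out_step(2)[of _ R])
  show "\<exists>y\<in>I w. R x y" if "x \<in> I w" for x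
    using that assms(2) in_step by simp
  show "I w \<noteq> {}"
    using assms(1) mem_I by blast
  show "\<not> R y x" if "R x y" for x y
    using that by (rule arc_asym)
qed simp

section \<open>Eight vertices\<close>

text \<open>For eight vertices \<open>sum_e\<close> makes twice the total excess plus the sum of
  squares of the part sizes equal to 16, so no part has size 5 or more.\<close>

lemma part_sizes_8:
  assumes "card V = 8"
  obtains q :: "nat \<Rightarrow> nat" where "q 1 + q 2 + q 3 + q 4 = k"
    and "q 1 + 2 * q 2 + 3 * q 3 + 4 * q 4 = 8"
    and "2 * (\<Sum>u\<in>V. e u) + q 1 + 4 * q 2 + 9 * q 3 + 16 * q 4 = 16"
    and "\<And>j. card {v \<in> V. sz v = j} = j * q j"
    and "\<And>v. v \<in> V \<Longrightarrow> sz v \<in> {1, 2, 3, 4} \<and> 0 < q (sz v)"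
proof -
  obtain q where q: "(\<Sum>j=1..card V. q j) = k" "\<And>j. card {v \<in> V. sz v = j} = j * q j"
    "(\<Sum>j=1..card V. j * q j) = card V" "(\<Sum>j=1..card V. j * j * q j) = (\<Sum>v\<in>V. sz v)"
    by (rule part_sizes) blast
  have sums: "q 1 + q 2 + q 3 + q 4 + q 5 + q 6 + q 7 + q 8 = k"
    "q 1 + 2 * q 2 + 3 * q 3 + 4 * q 4 + 5 * q 5 + 6 * q 6 + 7 * q 7 + 8 * q 8 = 8"
    "2 * (\<Sum>u\<in>V. e u) + q 1 + 4 * q 2 + 9 * q 3 + 16 * q 4 + 25 * q 5 + 36 * q 6 + 49 * q 7 + 64 * q 8 = 16"
    using q(1,3) q(4)[symmetric] sum_e unfolding assms sum_1_8 by linarith+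
  then have zero: "q 5 = 0" "q 6 = 0" "q 7 = 0" "q 8 = 0"
    by linarith+
  have pos: "0 < q (sz v)" if "v \<in> V" for v
  proof -
    have "card {w \<in> V. sz w = sz v} \<noteq> 0"
      using that finite_V by auto
    then show ?thesis
      using q(2)[of "sz v"] by simp
  qed
  have "sz v \<in> {1, 2, 3, 4}" if "v \<in> V" for v
  proof -
    have "sz v \<le> 8" "1 \<le> sz v"
      using degree_sum[OF that] sz_pos[OF that] assms by simp_all
    moreover have "sz v \<noteq> 5" "sz v \<noteq> 6" "sz v \<noteq> 7" "sz v \<noteq> 8"
      using pos[OF that] zero by auto
    ultimately show ?thesis
      by auto
  qed
  then show thesis
    using that[of q] sums zero q(2) pos by simp
qed

lemma N_cycle_weight_8:
  assumes "card V = 8" "N u = {w, x, y}" "w \<noteq> x" "w \<noteq> y" "x \<noteq> y"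
  shows "e w + sz w + e x + sz x + e y + sz y \<le> 5"
  using N_cycle_weight[OF assms(2-5)] assms(1) by simp

lemma N_triple_in_V:
  assumes "N u = {w, x, y}"
  shows "R u w" "R u x" "R u y" "u \<in> V" "w \<in> V" "x \<in> V" "y \<in> V"
    "1 \<le> sz w" "1 \<le> sz x" "1 \<le> sz y"
proof -
  show "R u w" "R u x" "R u y"
    using assms unfolding N_def by blast+
  then show "u \<in> V" "w \<in> V" "x \<in> V" "y \<in> V"
    using arc_in_V by blast+
  then show "1 \<le> sz w" "1 \<le> sz x" "1 \<le> sz y"
    using sz_pos by blast+
qed

text \<open>Four parts with sum of squares at most 16 all have size 2, and no excess is left. Any
  out-neighbourhood is then a triangle of weight 6, above the bound 5 of
  \<open>N_cycle_weight_8\<close>.\<close>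

lemma k_ne_4_if_card_8:
  assumes n: "card V = 8"
  shows "k \<noteq> 4"
proof
  assume "k = 4"
  obtain q where q: "q 1 + q 2 + q 3 + q 4 = k"
    "q 1 + 2 * q 2 + 3 * q 3 + 4 * q 4 = 8"
    "2 * (\<Sum>u\<in>V. e u) + q 1 + 4 * q 2 + 9 * q 3 + 16 * q 4 = 16"
    "\<And>j. card {v \<in> V. sz v = j} = j * q j"
    "\<And>v. v \<in> V \<Longrightarrow> sz v \<in> {1, 2, 3, 4} \<and> 0 < q (sz v)"
    by (rule part_sizes_8[OF n]) blast
  have zero: "q 1 = 0" "q 3 = 0" "q 4 = 0" "(\<Sum>u\<in>V. e u) = 0"
    using q(1-3) \<open>k = 4\<close> by linarith+
  have sz: "sz v = 2" if "v \<in> V" for v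
    using q(5)[OF that] zero(1-3) by auto
  obtain u where "u \<in> V"
    using n by fastforce
  then have "e u = 0"
    using zero(4) finite_V by simp
  moreover obtain w where "R u w"
    using N_nonempty[OF \<open>u \<in> V\<close>] unfolding N_def by blast
  ultimately obtain x y where "N u = {w, x, y}" "w \<noteq> x" "w \<noteq> y" "x \<noteq> y"
    by (rule N_cycle)
  then show False
    using N_cycle_weight_8[OF n, of u w x y] N_triple_in_V[of u w x y] sz by simp
qed

text \<open>The possible part sizes are 3, 2, 1, 1, 1 without excess and 2, 2, 2, 1, 1 with excess
  1. In both cases triangles are so light that they must use singleton parts, until two of these
  dominate each other.\<close>

lemma k_ne_5_if_card_8:
  assumes n: "card V = 8"
  shows "k \<noteq> 5"
proof
  assume "k = 5"
  obtain q where q: "q 1 + q 2 + q 3 + q 4 = k"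
    "q 1 + 2 * q 2 + 3 * q 3 + 4 * q 4 = 8"
    "2 * (\<Sum>u\<in>V. e u) + q 1 + 4 * q 2 + 9 * q 3 + 16 * q 4 = 16"
    "\<And>j. card {v \<in> V. sz v = j} = j * q j"
    "\<And>v. v \<in> V \<Longrightarrow> sz v \<in> {1, 2, 3, 4} \<and> 0 < q (sz v)"
    by (rule part_sizes_8[OF n]) blast
  define T where "T = {v \<in> V. sz v = 1}"
  have T_sub: "T \<subseteq> V" "finite T" and T_card: "card T = q 1"
    using finite_V q(4)[of 1] by (simp_all add: T_def)
  have "q 3 = 0 \<or> q 3 = 1" "q 4 = 0"
    using q(1-3) \<open>k = 5\<close> by linarith+
  then consider "q 1 = 3" "q 2 = 1" "(\<Sum>u\<in>V. e u) = 0" | "q 1 = 2" "(\<Sum>u\<in>V. e u) = 1"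
    using q(1-3) \<open>k = 5\<close> by linarith
  then show False
  proof cases
    case 1
    have e: "e v = 0" if "v \<in> V" for v
      using 1(3) that finite_V by simp
    \<comment> \<open>Two adjacent vertices in parts of size 2 would need two such parts, but there
      is one. In a triangle of weight at most 5 the third vertex leaves at most 4 for the
      pair.\<close>
    have pair: "sz a = 1 \<or> sz b = 1" if "R a b" "sz a + sz b \<le> 4" for a b
    proof (rule ccontr)
      assume "\<not> ?thesis"
      moreover have "1 \<le> sz a" "1 \<le> sz b"
        using that(1) arc_in_V sz_pos by blast+
      ultimately have "sz a = 2" "sz b = 2"
        using that(2) by linarith+
      then show False
        using sz_add_le[OF that(1), of 2] q(4)[of 2] 1(2) by simp
    qed
    \<comment> \<open>At least two vertices of the triangle \<open>N s\<close> are singleton parts;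
      as \<open>T\<close> has three elements, these are all the others.\<close>
    have dominates: "T - {s} \<subseteq> N s" if "s \<in> T" for s
    proof -
      have "s \<in> V" "e s = 0"
        using that e T_sub by auto
      obtain w where "R s w"
        using N_nonempty[OF \<open>s \<in> V\<close>] unfolding N_def by blast
      obtain x y where N: "N s = {w, x, y}" "R w x" "R x y" "R y w" "w \<noteq> x" "w \<noteq> y" "x \<noteq> y"
        using \<open>e s = 0\<close> \<open>R s w\<close> by (rule N_cycle)
      note V = N_triple_in_V[OF N(1)]
      have sum: "sz w + sz x + sz y \<le> 5"
        using N_cycle_weight_8[OF n N(1,5-7)] by linarith
      have "sz w = 1 \<or> sz x = 1" "sz x = 1 \<or> sz y = 1" "sz y = 1 \<or> sz w = 1"
        using pair[OF N(2)] pair[OF N(3)] pair[OF N(4)] sum V(8-10) by linarith+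
      then have "\<exists>a b. a \<noteq> b \<and> {a, b} \<subseteq> N s \<inter> T"
        using N(1,5-7) V(5-7) unfolding T_def by (cases "sz w = 1"; cases "sz x = 1") auto
      then obtain a b where ab: "a \<noteq> b" "{a, b} \<subseteq> N s \<inter> T"
        by blast
      then have "{a, b} \<subseteq> T - {s}"
        using arc_irrefl by auto
      moreover have "card (T - {s}) = card {a, b}"
        using that T_card T_sub 1(1) ab(1) by simp
      ultimately have "{a, b} = T - {s}"
        using T_sub by (intro card_subset_eq) auto
      then show ?thesis
        using ab(2) by blast
    qed
    have "\<not> T \<subseteq> {s}" for s
      using T_card 1(1) card_mono[of "{s}" T] by auto
    moreover have "T \<noteq> {}"
      using T_card 1(1) by auto
    ultimately obtain s t where "s \<in> T" "t \<in> T" "s \<noteq> t"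
      by blast
    then have "R s t" "R t s"
      using dominates[of s] dominates[of t] by auto
    then show False
      using arc_asym by blast
  next
    case 2
    then obtain s t where T: "T = {s, t}" "s \<noteq> t"
      using T_card card_2_iff by metis
    \<comment> \<open>Without a singleton part the triangle \<open>N a\<close> would weigh at least
      6, so it contains \<open>b\<close>. The other two vertices then weigh at least 2 each, which
      leaves no excess for \<open>b\<close>, and the argument repeats from \<open>b\<close>.\<close>
    have step: "R a b \<and> e b = 0" if "T = {a, b}" "a \<noteq> b" "e a = 0" for a b
    proof -
      have "a \<in> V"
        using that(1) T_sub by blast
      obtain w where "R a w"
        using N_nonempty[OF \<open>a \<in> V\<close>] unfolding N_def by blast
      obtain x y where N: "N a = {w, x, y}" "w \<noteq> x" "w \<noteq> y" "x \<noteq> y"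
        using \<open>e a = 0\<close> \<open>R a w\<close> by (rule N_cycle)
      note V = N_triple_in_V[OF N(1)]
      have T_iff: "v \<in> T \<longleftrightarrow> sz v = 1" if "v \<in> V" for v
        using that by (simp add: T_def)
      have "w \<in> T \<or> x \<in> T \<or> y \<in> T"
        using N_cycle_weight_8[OF n N] V(8-10) T_iff[OF V(5)] T_iff[OF V(6)] T_iff[OF V(7)]
        by linarith
      then have "R a b"
        using that(1) V arc_irrefl by blast
      then obtain x y where N: "N a = {b, x, y}" "b \<noteq> x" "b \<noteq> y" "x \<noteq> y"
        using N_cycle[OF \<open>e a = 0\<close>] by metis
      note V = N_triple_in_V[OF N(1)]
      have "x \<notin> T" "y \<notin> T"
        using that(1) N(2,3) V(2,3) arc_irrefl by auto
      then have "sz x \<noteq> 1" "sz y \<noteq> 1"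
        using T_iff V by blast+
      moreover have "sz b = 1"
        using that(1) T_def by blast
      ultimately have "e b = 0"
        using N_cycle_weight_8[OF n N] V(8-10) by linarith
      then show ?thesis
        using \<open>R a b\<close> by blast
    qed
    have "e s + e t \<le> 1"
      using sum_e_le[of "{s, t}"] T T_sub 2(2) by simp
    then consider "e s = 0" | "e t = 0"
      by linarith
    then have "R s t \<and> R t s"
      by cases (use step[of s t] step[of t s] T in \<open>auto simp: insert_commute\<close>)
    then show False
      using arc_asym by blast
  qed
qed

text \<open>Part sizes 3, 1, 1, 1, 1, 1 with a single vertex \<open>z\<close> of out-degree 4. If
  \<open>z\<close> lies in the large part \<open>A\<close>, a triangle through it is too heavy.
  Otherwise the six arcs into \<open>A\<close> are charged to distinct out-neighbours of
  \<open>z\<close>, of which there are four.\<close>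

lemma single_exceeding_6_8:
  assumes n: "card V = 8"
    and sz: "\<And>v. v \<in> V \<Longrightarrow> sz v = 1 \<or> sz v = 3" "card {v \<in> V. sz v = 3} = 3"
    and sum: "(\<Sum>u\<in>V. e u) = 1"
  shows False
proof -
  obtain z where z: "z \<in> V" "e z = 1" "\<And>v. v \<in> V \<Longrightarrow> v \<noteq> z \<Longrightarrow> e v = 0"
    using sum sum_eq_Suc0_iff[OF finite_V, of e] by auto
  define A where "A = {v \<in> V. sz v = 3}"
  define T where "T = {v \<in> V. sz v = 1}"
  have fin: "finite A" "finite T" "A \<subseteq> V" "T \<subseteq> V" "A \<inter> T = {}"
    using finite_V by (auto simp: A_def T_def)
  have card_A: "card A = 3"
    using sz(2) by (simp add: A_def)
  have "P (c a) = A" if "a \<in> A" for a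
    using that card_A fin by (intro card_subset_eq) (auto simp: A_def sz_def)
  then have I_A: "I a \<subseteq> T" if "a \<in> A" for a
    using that arc_color[of _ a] arc_in_V[of _ a] sz(1) unfolding A_def T_def
    by (smt (verit) mem_Collect_eq mem_I mem_P subsetI)
  show False
  proof (cases "z \<in> A")
    case True
    then have "sz z = 3"
      by (simp add: A_def)
    then have "card (I z) = 1"
      using card_I[OF z(1)] z(2) n by simp
    then obtain u where "R u z"
      using card_1_singletonE mem_I by (metis insertI1)
    then have "e u = 0"
      using z(3) arc_in_V arc_irrefl by blast
    then obtain x y where N: "N u = {z, x, y}" "z \<noteq> x" "z \<noteq> y" "x \<noteq> y"
      using \<open>R u z\<close> by (rule N_cycle)
    show False
      using N_cycle_weight_8[OF n N] N_triple_in_V(9,10)[OF N(1)] z(2) \<open>sz z = 3\<close> by linarith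
  next
    case False
    then have "z \<in> T" "sz z = 1"
      using z(1) sz(1) by (auto simp: A_def T_def)
    \<comment> \<open>A triangle meeting \<open>A\<close> already weighs 3 + 1 + 1, so it contains
      no second vertex of \<open>A\<close> and not \<open>z\<close>; hence \<open>z\<close>
      dominates \<open>u\<close>.\<close>
    have few: "card (N u \<inter> A) \<le> of_bool (R z u)" if "u \<in> T - {z}" for u
    proof (cases "N u \<inter> A = {}")
      case False
      then obtain a where a: "R u a" "a \<in> A"
        by auto
      have "e u = 0" "u \<in> V"
        using that z(3) fin by auto
      then obtain x y where N: "N u = {a, x, y}" "a \<noteq> x" "a \<noteq> y" "x \<noteq> y"
        using N_cycle a(1) by metis
      note V = N_triple_in_V[OF N(1)]
      have "sz a = 3"
        using a(2) by (simp add: A_def)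
      then have light: "e a = 0" "e x = 0" "e y = 0" "sz x = 1" "sz y = 1"
        using N_cycle_weight_8[OF n N] V(8-10) by linarith+
      then have "N u \<inter> A = {a}"
        using N(1) a(2) by (auto simp: A_def)
      moreover have "\<not> R u z"
        using light(1-3) z(2) N(1) mem_N[of z u] by auto
      then have "R z u"
        using singleton_arc[OF z(1) \<open>u \<in> V\<close>] that \<open>sz z = 1\<close> by blast
      ultimately show ?thesis
        by simp
    qed simp
    have "6 = (\<Sum>a\<in>A. card (I a \<inter> T))"
    proof -
      \<comment> \<open>The in-degree is 8 - 3 - 3, and all these arcs come from
        \<open>T\<close>.\<close>
      have "card (I a \<inter> T) = 2" if "a \<in> A" for a
      proof -
        have "a \<in> V" "a \<noteq> z" "sz a = 3"
          using that False by (auto simp: A_def)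
        then show ?thesis
          using I_A[OF that] card_I[of a] z(3)[of a] n by (simp add: Int_absorb2)
      qed
      then show ?thesis
        using card_A by simp
    qed
    also have "\<dots> = (\<Sum>u\<in>T. card (N u \<inter> A))"
      using arc_count[OF fin(2,1)] by simp
    also have "\<dots> = card (N z \<inter> A) + (\<Sum>u\<in>T - {z}. card (N u \<inter> A))"
      using \<open>z \<in> T\<close> fin(2) by (simp add: sum.remove)
    also have "\<dots> \<le> card (N z \<inter> A) + (\<Sum>u\<in>T - {z}. of_bool (R z u))"
      using few by (intro add_left_mono sum_mono)
    also have "(\<Sum>u\<in>T - {z}. of_bool (R z u)) = card ((T - {z}) \<inter> N z)"
      using fin(2) by (simp add: Int_def N_def)
    \<comment> \<open>An arc from \<open>z\<close> into \<open>A\<close> is charged to its head, an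
      arc from another \<open>u\<close> to \<open>u\<close> itself.\<close>
    also have "card (N z \<inter> A) + \<dots> = card ((N z \<inter> A) \<union> ((T - {z}) \<inter> N z))"
      using fin(5) by (intro card_Un_disjoint[symmetric]) auto
    also have "\<dots> \<le> d z"
      unfolding d_def by (intro card_mono) auto
    finally show False
      using d_eq[OF z(1)] z(2) by simp
  qed
qed

text \<open>Part sizes 2, 2, 1, 1, 1, 1, where \<open>z\<close> and \<open>z'\<close> are singleton
  parts of out-degree 4. Besides these, \<open>T\<close> has just two vertices \<open>p\<close> and
  \<open>q\<close>. Each in-neighbour of \<open>z\<close> dominates one of them, and the triangle
  \<open>N p\<close> then forces arcs in both directions.\<close>

lemma two_exceeding_6_8:
  assumes n: "card V = 8"
    and sz: "\<And>v. v \<in> V \<Longrightarrow> sz v = 1 \<or> sz v = 2"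
    and card_sz: "card {v \<in> V. sz v = 1} = 4" "card {v \<in> V. sz v = 2} = 4"
    and z: "R z z'" "e z = 1" "e z' = 1" "\<And>v. v \<in> V \<Longrightarrow> v \<noteq> z \<Longrightarrow> v \<noteq> z' \<Longrightarrow> e v = 0"
    and sz_z: "sz z = 1" "sz z' = 1"
  shows False
proof -
  have V: "z \<in> V" "z' \<in> V" "z \<noteq> z'"
    using z(1) arc_in_V arc_irrefl by blast+
  have "card (I z) = 3"
    using card_I[OF V(1)] z(2) sz_z n by simp
  have in_z: "e u = 0" if "R u z" for u
    using z(4)[of u] that arc_in_V arc_asym[OF z(1)] arc_irrefl by metis
  define T where "T = {v \<in> V. sz v = 1}"
  have T: "finite T" "z \<in> T" "z' \<in> T" "card T = 4"
    using finite_V V sz_z card_sz by (simp_all add: T_def)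
  then have "card (T - {z, z'}) = 2"
    using V(3) by (simp add: card_Diff_subset)
  \<comment> \<open>\<open>z\<close> has weight 2 in the triangle \<open>N u\<close>, so the other
    two vertices weigh at most 3 together and one of them has weight 1.\<close>
  have light: "\<exists>v \<in> T - {z, z'}. R u v" if u: "R u z" for u
  proof -
    obtain x y where N: "N u = {z, x, y}" "z \<noteq> x" "z \<noteq> y" "x \<noteq> y"
      using N_cycle[OF in_z[OF u] u] by metis
    note V = N_triple_in_V[OF N(1)]
    have "e x = 0 \<and> sz x = 1 \<or> e y = 0 \<and> sz y = 1"
      using N_cycle_weight_8[OF n N] V(8-10) sz_z(1) z(2) by linarith
    then have "x \<in> T - {z, z'} \<or> y \<in> T - {z, z'}"
      using z(2,3) V(6,7) unfolding T_def by auto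
    then show ?thesis
      using V(2,3) by blast
  qed
  \<comment> \<open>Otherwise the three in-neighbours of \<open>z\<close> lie in parts of size 2.
    Having no sink they form a directed triangle, which needs three such parts, but there are
    two.\<close>
  have "\<exists>p \<in> I z. sz p = 1"
  proof (rule ccontr)
    assume none: "\<not> ?thesis"
    have "I z \<noteq> {}"
      using \<open>card (I z) = 3\<close> by auto
    moreover have step: "\<exists>y\<in>I z. R x y" if "x \<in> I z" for x
      using that in_z in_step by simp
    ultimately obtain x y t where xyt: "{x, y, t} \<subseteq> I z" "R x y" "R y t" "x \<noteq> y" "y \<noteq> t" "x \<noteq> t"
      using card_ge_3_if_out_step(1)[of "I z" R] arc_asym by (metis finite_I)
    then have "{x, y, t} = I z"
      using \<open>card (I z) = 3\<close> by (intro card_subset_eq) auto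
    then have "R t x"
      using step[of t] xyt arc_asym arc_irrefl by (metis insertE insertI1 insert_commute singletonD)
    moreover have "sz x = 2" "sz y = 2" "sz t = 2"
      using none sz xyt(1) I_sub by (meson insert_subset subsetD)+
    ultimately show False
      using sz_add_le_3[OF xyt(2,3), of 2] card_sz(2) by simp
  qed
  then obtain p where p: "R p z" "sz p = 1"
    by auto
  have "p \<in> T - {z, z'}"
    using p arc_in_V arc_irrefl arc_asym z(1) unfolding T_def by blast
  obtain q where q: "R p q" "q \<in> T - {z, z'}"
    using light[OF p(1)] by blast
  have "p \<noteq> q"
    using q(1) arc_irrefl by blast
  then have "{p, q} = T - {z, z'}"
    using \<open>p \<in> T - {z, z'}\<close> q(2) \<open>card (T - {z, z'}) = 2\<close> T(1) by (intro card_subset_eq) auto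
  \<comment> \<open>\<open>q\<close> is \<open>x\<close> or \<open>y\<close>. As an in-neighbour of
    \<open>z\<close>, \<open>y\<close> dominates \<open>p\<close> or \<open>q\<close>, hence
    \<open>q\<close>; so \<open>q\<close> is \<open>x\<close>, which dominates
    \<open>y\<close>.\<close>
  obtain x y where N: "N p = {z, x, y}" "R z x" "R x y" "R y z" "z \<noteq> x" "z \<noteq> y" "x \<noteq> y"
    using N_cycle[OF in_z[OF p(1)] p(1)] by metis
  note V_N = N_triple_in_V[OF N(1)]
  have q_xy: "q = x \<or> q = y"
    using q N(1) mem_N[of q p] by auto
  have y_p: "\<not> R y p"
    using V_N(3) arc_asym by blast
  obtain r where r: "r \<in> {p, q}" "R y r"
    using light[OF N(4)] \<open>{p, q} = T - {z, z'}\<close> by auto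
  then have "r = q"
    using y_p by blast
  then have "q \<noteq> y"
    using r(2) arc_irrefl by blast
  then have "R q y"
    using q_xy N(3) by blast
  then show False
    using r(2) \<open>r = q\<close> arc_asym by blast
qed

text \<open>The possible part sizes are 3, 1, 1, 1, 1, 1 with excess 1 and 2, 2, 1, 1, 1, 1 with
  excess 2. In the second case in-degrees force the excess to be split between two singleton
  parts.\<close>

lemma k_ne_6_if_card_8:
  assumes n: "card V = 8"
  shows "k \<noteq> 6"
proof
  assume "k = 6"
  obtain q where q: "q 1 + q 2 + q 3 + q 4 = k"
    "q 1 + 2 * q 2 + 3 * q 3 + 4 * q 4 = 8"
    "2 * (\<Sum>u\<in>V. e u) + q 1 + 4 * q 2 + 9 * q 3 + 16 * q 4 = 16"
    "\<And>j. card {v \<in> V. sz v = j} = j * q j"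
    "\<And>v. v \<in> V \<Longrightarrow> sz v \<in> {1, 2, 3, 4} \<and> 0 < q (sz v)"
    by (rule part_sizes_8[OF n]) blast
  have "q 3 = 0 \<or> q 3 = 1" "q 4 = 0"
    using q(1-3) \<open>k = 6\<close> by linarith+
  then consider "q 2 = 0" "q 3 = 1" "q 4 = 0" "(\<Sum>u\<in>V. e u) = 1"
    | "q 1 = 4" "q 2 = 2" "q 3 = 0" "q 4 = 0" "(\<Sum>u\<in>V. e u) = 2"
    using q(1-3) \<open>k = 6\<close> by linarith
  then show False
  proof cases
    case 1
    have "sz v = 1 \<or> sz v = 3" if "v \<in> V" for v
      using q(5)[OF that] 1 by auto
    then show False
      using single_exceeding_6_8[OF n] q(4)[of 3] 1 by simp
  next
    case 2
    have sz: "sz v = 1 \<or> sz v = 2" if "v \<in> V" for v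
      using q(5)[OF that] 2 by auto
    have pair: "e u + e v \<le> 2" if "u \<in> V" "v \<in> V" "u \<noteq> v" for u v
      using sum_e_le[of "{u, v}"] that 2(5) by simp
    have triple: "e u + e v + e w \<le> 2"
      if "u \<in> V" "v \<in> V" "w \<in> V" "u \<noteq> v" "u \<noteq> w" "v \<noteq> w" for u v w
      using sum_e_le[of "{u, v, w}"] that 2(5) by simp
    obtain z where z: "z \<in> V" "1 \<le> e z"
      using 2(5) by (metis One_nat_def Suc_leI gr_zeroI sum.neutral zero_neq_numeral)
    \<comment> \<open>With excess 2 the in-degree of \<open>z\<close> is \<open>3 - sz z\<close>,
      positive but below the bound 3 of \<open>card_I_ge_3\<close>.\<close>
    have "e z \<le> 1"
    proof (rule ccontr)
      assume "\<not> ?thesis"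
      then have "e z = 2"
        using sum_e_le[of "{z}"] z(1) 2(5) by simp
      then have zero: "e v = 0" if "v \<in> V" "v \<noteq> z" for v
        using pair[OF z(1) that(1)] that(2) by auto
      have "card (I z) = 3 - sz z" "sz z \<le> 2" "1 \<le> sz z"
        using card_I[OF z(1)] \<open>e z = 2\<close> n sz[OF z(1)] by auto
      moreover have "e u = 0" if "R u z" for u
        using zero that arc_in_V arc_irrefl by blast
      moreover have "\<exists>u. R u z"
        using calculation(1-3) by (metis Int_emptyI card.empty diff_is_0_eq ex_in_conv mem_I not_less_eq_eq numeral_2_eq_2 numeral_3_eq_3 le_trans)
      ultimately show False
        using card_I_ge_3[of _ z] by fastforce
    qed
    then have "e z = 1"
      using z(2) by simp
    have "(\<Sum>u\<in>V - {z}. e u) = 1"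
      using 2(5) z(1) \<open>e z = 1\<close> finite_V by (simp add: sum.remove[of V z])
    then obtain z' where z': "z' \<in> V" "z' \<noteq> z" "e z' = 1"
      using sum_eq_Suc0_iff[of "V - {z}" e] finite_V by auto
    have zero: "e v = 0" if "v \<in> V" "v \<noteq> z" "v \<noteq> z'" for v
      using triple[OF z(1) z'(1) that(1)] that(2,3) z'(2,3) \<open>e z = 1\<close> by auto
    \<comment> \<open>If \<open>sz a\<close> were 2, the in-degree of \<open>a\<close> would be 2.
      By \<open>card_I_ge_3\<close> then \<open>b\<close> is an in-neighbour, the other in-neighbour
      \<open>u\<close> dominates \<open>b\<close> by \<open>in_step\<close>, and the triangle
      \<open>N u\<close> through \<open>a\<close> and \<open>b\<close> weighs at least 3 + 2 +
      1.\<close>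
    have no_double: "sz a = 1"
      if ab: "a \<in> V" "e a = 1" "e b = 1" "\<And>v. v \<in> V \<Longrightarrow> v \<noteq> a \<Longrightarrow> v \<noteq> b \<Longrightarrow> e v = 0" for a b
    proof (rule ccontr)
      assume "sz a \<noteq> 1"
      then have "sz a = 2"
        using sz ab(1) by blast
      then have card: "card (I a) = 2"
        using card_I[OF ab(1)] ab(2) n by simp
      have "R b a"
      proof (rule ccontr)
        assume "\<not> R b a"
        then have "e u = 0" if "R u a" for u
          using ab(4)[of u] that arc_in_V arc_irrefl by metis
        moreover have "I a \<noteq> {}"
          using card by auto
        ultimately show False
          using card_I_ge_3[of _ a] card by fastforce
      qed
      moreover obtain u where u: "I a = {b, u}" "u \<noteq> b"
        using card \<open>R b a\<close> by (metis card_2_iff doubleton_eq_iff insertE mem_I singletonD)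
      then have "R u a"
        using mem_I[of u a] by blast
      then have "e u = 0"
        using ab(4)[of u] u(2) arc_in_V arc_irrefl by metis
      then obtain x y where N: "N u = {a, x, y}" "a \<noteq> x" "a \<noteq> y" "x \<noteq> y"
        using N_cycle \<open>R u a\<close> by metis
      note V_N = N_triple_in_V[OF N(1)]
      have "R u b"
        using in_step[OF \<open>R u a\<close> \<open>e u = 0\<close>] u(1) arc_irrefl by auto
      then have "b = x \<or> b = y"
        using N(1) \<open>R b a\<close> arc_irrefl mem_N[of b u] by auto
      then show False
        using N_cycle_weight_8[OF n N] V_N(8-10) \<open>sz a = 2\<close> ab(2,3) by auto
    qed
    have sz_z: "sz z = 1" "sz z' = 1"
      using no_double[of z z'] no_double[of z' z] z z' \<open>e z = 1\<close> zero by blast+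
    have "card {v \<in> V. sz v = 1} = 4" "card {v \<in> V. sz v = 2} = 4"
      using q(4)[of 1] q(4)[of 2] 2 by simp_all
    then show False
      using two_exceeding_6_8[OF n sz, of z z'] two_exceeding_6_8[OF n sz, of z' z]
        singleton_arc[of z z'] z z' \<open>e z = 1\<close> zero sz_z by blast
  qed
qed

section \<open>Four parts and nine vertices\<close>

lemma partition_four:
  assumes "k = 4" and "card {c u, c w, c x, c y} = 4" and "{u, w, x, y} \<subseteq> V"
  shows "sz u + sz w + sz x + sz y = card V" and "v \<in> V \<Longrightarrow> c v \<in> {c u, c w, c x, c y}"
proof -
  have "{c u, c w, c x, c y} = c ` V"
    using assms card_parts finite_V by (intro card_subset_eq) auto
  then have "V = P (c u) \<union> (P (c w) \<union> (P (c x) \<union> P (c y)))"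
    and "v \<in> V \<Longrightarrow> c v \<in> {c u, c w, c x, c y}"
    by auto
  moreover have "distinct [c u, c w, c x, c y]"
    using assms(2) card_distinct[of "[c u, c w, c x, c y]"] by simp
  then have "card (P (c u) \<union> (P (c w) \<union> (P (c x) \<union> P (c y)))) = sz u + (sz w + (sz x + sz y))"
    unfolding sz_def
    by (subst card_Un_disjoint, simp, simp, force)+ simp
  ultimately show "sz u + sz w + sz x + sz y = card V" "v \<in> V \<Longrightarrow> c v \<in> {c u, c w, c x, c y}"
    by simp_all
qed

text \<open>With four parts, \<open>u\<close> and the triangle \<open>N u\<close> are four pairwise
  adjacent vertices and so meet every part.\<close>

lemma N_cycle_colors:
  assumes "k = 4" "e u = 0" "R u w"
  obtains x y where "N u = {w, x, y}" "w \<noteq> x" "w \<noteq> y" "x \<noteq> y"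
    "sz u + sz w + sz x + sz y = card V"
    "\<And>v. v \<in> V \<Longrightarrow> c v \<noteq> c u \<Longrightarrow> c v \<in> {c w, c x, c y}"
proof -
  obtain x y where N: "N u = {w, x, y}" "R w x" "R x y" "R y w" "w \<noteq> x" "w \<noteq> y" "x \<noteq> y"
    using N_cycle assms(2,3) by metis
  then have "R u x" "R u y"
    using mem_N[of x u] mem_N[of y u] by blast+
  then have card: "card {c u, c w, c x, c y} = 4"
    using arc_color[OF N(2)] arc_color[OF N(3)] arc_color[OF N(4)] arc_color[OF assms(3)]
      arc_color[of u x] arc_color[of u y] by simp
  have sub: "{u, w, x, y} \<subseteq> V"
    using arc_in_V assms(3) \<open>R u x\<close> \<open>R u y\<close> by simp
  note four = partition_four[OF assms(1) card sub]
  show thesis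
  proof (rule that[OF N(1,5,6,7) four(1)])
    show "c v \<in> {c w, c x, c y}" if "v \<in> V" "c v \<noteq> c u" for v
      using four(2)[OF that(1)] that(2) by simp
  qed
qed

text \<open>The triangle \<open>N u\<close> meets the three parts other than that of
  \<open>u\<close>, so its sizes add up to \<open>9 - sz u\<close>; inserting this in
  \<open>N_cycle_weight\<close> turns the bound into one on \<open>sz u\<close>.\<close>

lemma N_excess_9:
  assumes "k = 4" "card V = 9" "u \<in> V" "e u = 0"
  shows "(\<Sum>w\<in>N u. e w) + 2 \<le> sz u"
proof -
  obtain w where "R u w"
    using N_nonempty[OF assms(3)] unfolding N_def by blast
  then obtain x y where N: "N u = {w, x, y}" "w \<noteq> x" "w \<noteq> y" "x \<noteq> y"
    "sz u + sz w + sz x + sz y = card V"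
    using N_cycle_colors assms(1,4) by metis
  then show ?thesis
    using N_cycle_weight[OF N(1-4)] assms(2) by simp
qed

text \<open>By \<open>N_excess_9\<close> an in-neighbour of \<open>w\<close> would lie in a part of
  size at least 5, so \<open>w\<close> is a source. For \<open>u\<close> in a part of size 2 the
  codegrees sum to the least possible value, yet \<open>w\<close> dominates two vertices of
  \<open>N u\<close>.\<close>

lemma single_exceeding_4_9:
  assumes k: "k = 4" and n: "card V = 9"
    and sz: "\<And>v. v \<in> V \<Longrightarrow> sz v = 2 \<or> sz v = 3"
    and w: "w \<in> V" "e w = 3" "\<And>v. v \<in> V \<Longrightarrow> v \<noteq> w \<Longrightarrow> e v = 0"
    and A: "{v \<in> V. sz v = 2} \<noteq> {}"
  shows False
proof -
  have le: "e w + 2 \<le> sz u" if "R u w" for u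
  proof -
    have "u \<in> V" "u \<noteq> w"
      using that arc_in_V arc_irrefl by auto
    moreover have "e w \<le> (\<Sum>v\<in>N u. e v)"
      using that member_le_sum[of w "N u" e] by simp
    ultimately show ?thesis
      using N_excess_9[OF k n] w(3) by fastforce
  qed
  have "I w = {}"
  proof (rule equals0I)
    fix u assume "u \<in> I w"
    then have "R u w" "u \<in> V"
      using I_sub[of w] by auto
    then show False
      using le[of u] sz[of u] w(2) by linarith
  qed
  then have "sz w = 3"
    using card_I[OF w(1)] w(2) n by simp
  obtain u where u: "u \<in> V" "sz u = 2"
    using A by blast
  then have "u \<noteq> w"
    using \<open>sz w = 3\<close> by auto
  then have "e u = 0"
    using u(1) w(3) by blast
  obtain x0 where "R u x0"
    using N_nonempty[OF u(1)] unfolding N_def by blast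
  then obtain x y t where N: "N u = {x, y, t}" "x \<noteq> y" "x \<noteq> t" "y \<noteq> t"
    "sz u + sz x + sz y + sz t = card V"
    using N_cycle_colors[OF k \<open>e u = 0\<close>] by metis
  have V: "v \<in> V" "e v = 0" "v \<noteq> w" if "v \<in> N u" for v
  proof -
    show "v \<in> V" "v \<noteq> w"
      using that N_sub[of u] \<open>I w = {}\<close> mem_I[of u w] by auto
    then show "e v = 0"
      by (rule w(3))
  qed
  \<comment> \<open>In-degrees \<open>6 - sz v\<close>, for three parts of total size 9 - 2, give 18
    - 7.\<close>
  have "(\<Sum>v\<in>N u. card (I v)) = 11"
    using N(1-5) V[of x] V[of y] V[of t] card_I[of x] card_I[of y] card_I[of t] n u(2) by simp
  then have codegrees: "(\<Sum>v\<in>V - {u}. card (N u \<inter> N v)) = 8"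
    using codegree_sum_minus[OF u(1)] d_eq[OF u(1)] \<open>e u = 0\<close> by simp
  have "(\<Sum>v\<in>V - {u} - {w}. 1) \<le> (\<Sum>v\<in>V - {u} - {w}. card (N u \<inter> N v))"
    using codegree_pos[OF u(1)] by (intro sum_mono) auto
  then have "7 \<le> (\<Sum>v\<in>V - {u} - {w}. card (N u \<inter> N v))"
    using n finite_V u(1) w(1) \<open>u \<noteq> w\<close> by simp
  then have "card (N u \<inter> N w) \<le> 1"
    using codegrees finite_V w(1) \<open>u \<noteq> w\<close> by (simp add: sum.remove[of "V - {u}" w])
  moreover have dominated: "R w v" if "v \<in> N u" "sz v = 2" for v
  proof -
    have "c v \<noteq> c w"
      using that(2) \<open>sz w = 3\<close> by (auto simp: sz_def)
    moreover have "\<not> R v w"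
      using \<open>I w = {}\<close> by auto
    ultimately show ?thesis
      using V[OF that(1)] arcI[OF w(1)] by metis
  qed
  have two: "sz a = 2 \<Longrightarrow> sz b = 2 \<Longrightarrow> a \<in> N u \<Longrightarrow> b \<in> N u \<Longrightarrow> a \<noteq> b \<Longrightarrow> 2 \<le> card (N u \<inter> N w)" for a b
    using card_mono[of "N u \<inter> N w" "{a, b}"] dominated by simp
  have "sz x = 2 \<and> sz y = 2 \<or> sz x = 2 \<and> sz t = 2 \<or> sz y = 2 \<and> sz t = 2"
    using N(5) n u(2) sz[OF V(1), of x] sz[OF V(1), of y] sz[OF V(1), of t] N(1) by auto
  then have "2 \<le> card (N u \<inter> N w)"
    using two[of x y] two[of x t] two[of y t] N(1-4) by blast
  ultimately show False
    by simp
qed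

text \<open>Twice the excess plus the sum of squares of the part sizes is 27. Singleton parts demand
  too much excess, and counting arcs then concentrates the excess in one vertex.\<close>

lemma k_ne_4_if_card_9:
  assumes n: "card V = 9"
  shows "k \<noteq> 4"
proof
  assume k: "k = 4"
  obtain q where q: "(\<Sum>j=1..card V. q j) = k" "\<And>j. card {v \<in> V. sz v = j} = j * q j"
    "(\<Sum>j=1..card V. j * q j) = card V" "(\<Sum>j=1..card V. j * j * q j) = (\<Sum>v\<in>V. sz v)"
    by (rule part_sizes) blast
  define E where "E = (\<Sum>u\<in>V. e u)"
  have sums: "q 1 + q 2 + q 3 + q 4 + q 5 + q 6 + q 7 + q 8 + q 9 = 4"
    "q 1 + 2 * q 2 + 3 * q 3 + 4 * q 4 + 5 * q 5 + 6 * q 6 + 7 * q 7 + 8 * q 8 + 9 * q 9 = 9"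
    "2 * E + q 1 + 4 * q 2 + 9 * q 3 + 16 * q 4 + 25 * q 5 + 36 * q 6 + 49 * q 7 + 64 * q 8
      + 81 * q 9 = 27"
    using q(1,3) q(4)[symmetric] sum_e unfolding n k sum_1_9 E_def by linarith+
  then have zero: "q 5 = 0" "q 6 = 0" "q 7 = 0" "q 8 = 0" "q 9 = 0"
    by linarith+
  have pos: "q (sz v) \<noteq> 0" if "v \<in> V" for v
  proof -
    have "card {w \<in> V. sz w = sz v} \<noteq> 0"
      using that finite_V by auto
    then show ?thesis
      using q(2)[of "sz v"] by simp
  qed
  have "q 1 = 0"
  proof (rule ccontr)
    assume "q 1 \<noteq> 0"
    then have "card {v \<in> V. sz v = 1} \<noteq> 0"
      using q(2)[of 1] by simp
    then have "{v \<in> V. sz v = 1} \<noteq> {}"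
      by (metis card.empty)
    then obtain s where s: "s \<in> V" "sz s = 1"
      by blast
    have e_s: "1 \<le> e v" if "v \<in> V" "sz v = 1" for v
      using N_excess_9[OF k n that(1)] that(2) by (cases "e v = 0") auto
    \<comment> \<open>If \<open>v\<close> had no excess, \<open>N v\<close> would meet the part of
      \<open>s\<close> and so contain a vertex with excess, against
      \<open>N_excess_9\<close>.\<close>
    have e_2: "1 \<le> e v" if v: "v \<in> V" "sz v = 2" for v
    proof (rule ccontr)
      assume "\<not> ?thesis"
      then have "e v = 0"
        by simp
      obtain w where "R v w"
        using N_nonempty[OF v(1)] unfolding N_def by blast
      then obtain x y where N: "N v = {w, x, y}"
        "\<And>a. a \<in> V \<Longrightarrow> c a \<noteq> c v \<Longrightarrow> c a \<in> {c w, c x, c y}"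
        using N_cycle_colors[OF k \<open>e v = 0\<close>] by metis
      have "c s \<noteq> c v"
        using s v by (auto simp: sz_def)
      then have "\<exists>a\<in>{w, x, y}. c a = c s"
        using N(2)[OF s(1)] by auto
      then obtain a where a: "a \<in> N v" "c a = c s"
        using N(1) by blast
      then have "a \<in> V" "sz a = 1"
        using N_sub[of v] s(2) by (auto simp: sz_def)
      then have "1 \<le> (\<Sum>w\<in>N v. e w)"
        using e_s[of a] a(1) member_le_sum[of a "N v" e] by simp
      then show False
        using N_excess_9[OF k n v(1) \<open>e v = 0\<close>] v(2) by simp
    qed
    \<comment> \<open>All vertices in parts of size at most 2 have excess, too much for each of 4,
      3, 1, 1 and 4, 2, 2, 1 and 3, 3, 2, 1.\<close>
    have "q 1 + 2 * q 2 = card ({v \<in> V. sz v = 1} \<union> {v \<in> V. sz v = 2})"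
      using q(2)[of 1] q(2)[of 2] finite_V by (subst card_Un_disjoint) auto
    also have "\<dots> \<le> (\<Sum>v\<in>{v \<in> V. sz v = 1} \<union> {v \<in> V. sz v = 2}. e v)"
      using e_s e_2 sum_mono[of "{v \<in> V. sz v = 1} \<union> {v \<in> V. sz v = 2}" "\<lambda>_. 1" e] by auto
    also have "\<dots> \<le> E"
      unfolding E_def by (rule sum_e_le) auto
    finally have "q 1 + 2 * q 2 \<le> E" .
    moreover have "q 4 = 0 \<or> q 4 = 1" "q 3 = 0 \<or> q 3 = 1 \<or> q 3 = 2"
      using sums zero by linarith+
    ultimately show False
      using sums zero \<open>q 1 \<noteq> 0\<close> by linarith
  qed
  moreover from this have "q 4 = 0"
    using sums zero by linarith
  ultimately have q_val: "q 2 = 3" "q 3 = 1" "q 4 = 0" "E = 3"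
    using sums zero by linarith+
  have sz: "sz v = 2 \<or> sz v = 3" if "v \<in> V" for v
  proof -
    have "1 \<le> sz v" "sz v \<le> 9"
      using sz_pos[OF that] degree_sum[OF that] n by simp_all
    moreover have "sz v \<notin> {1, 4, 5, 6, 7, 8, 9}"
      using pos[OF that] zero \<open>q 1 = 0\<close> q_val(3) by auto
    ultimately show ?thesis
      by auto
  qed
  \<comment> \<open>Only part sizes 3, 2, 2, 2 remain. Vertices of the large part \<open>A\<close> outside \<open>S\<close> send at most one arc
    to \<open>S\<close>, and other vertices outside \<open>S\<close> none; so there are too few arcs into \<open>S\<close> unless
    \<open>S\<close> is a singleton.\<close>
  define A where "A = {v \<in> V. sz v = 3}"
  define S where "S = {v \<in> V. 1 \<le> e v}"
  have fin: "finite A" "finite S" "A \<subseteq> V" "S \<subseteq> V"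
    using finite_V by (auto simp: A_def S_def)
  have "card A = 3"
    using q(2)[of 3] q_val by (simp add: A_def)
  have sum_S: "(\<Sum>v\<in>S. e v) = 3"
    using q_val(4) finite_V unfolding E_def S_def
    by (subst sum.mono_neutral_right[symmetric, of V]) auto
  have in_A: "u \<in> A" and out_S: "card (N u \<inter> S) \<le> 1" if "u \<in> V - S" "N u \<inter> S \<noteq> {}" for u
  proof -
    have "u \<in> V" "e u = 0"
      using that(1) by (auto simp: S_def)
    have "card (N u \<inter> S) \<le> (\<Sum>w\<in>N u \<inter> S. e w)"
      using sum_mono[of "N u \<inter> S" "\<lambda>_. 1" e] by (auto simp: S_def)
    also have "\<dots> \<le> (\<Sum>w\<in>N u. e w)"
      by (intro sum_mono2) auto
    finally have "card (N u \<inter> S) + 2 \<le> sz u"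
      using N_excess_9[OF k n \<open>u \<in> V\<close> \<open>e u = 0\<close>] by linarith
    moreover have "1 \<le> card (N u \<inter> S)"
      using that(2) by (simp add: Suc_le_eq card_gt_0_iff)
    ultimately have "sz u = 3" "card (N u \<inter> S) \<le> 1"
      using sz[OF \<open>u \<in> V\<close>] by linarith+
    then show "u \<in> A" "card (N u \<inter> S) \<le> 1"
      using \<open>u \<in> V\<close> by (simp_all add: A_def)
  qed
  have "(\<Sum>w\<in>S. card (I w)) = (\<Sum>w\<in>S. card (I w \<inter> V))"
    using I_sub by (simp add: Int_absorb2)
  also have "\<dots> = (\<Sum>u\<in>V. card (N u \<inter> S))"
    using arc_count[OF finite_V fin(2)] by simp
  also have "\<dots> = (\<Sum>u\<in>S. card (N u \<inter> S)) + (\<Sum>u\<in>V - S. card (N u \<inter> S))"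
    using fin finite_V by (simp add: sum.subset_diff[of S V] add.commute)
  also have "(\<Sum>u\<in>V - S. card (N u \<inter> S)) = (\<Sum>u\<in>A - S. card (N u \<inter> S))"
    using in_A fin finite_V by (intro sum.mono_neutral_right) auto
  also have "\<dots> \<le> card (A - S)"
  proof -
    have "card (N u \<inter> S) \<le> 1" if "u \<in> A - S" for u
      using out_S[of u] that fin(3) by (cases "N u \<inter> S = {}") auto
    then show ?thesis
      using sum_mono[of "A - S" "\<lambda>u. card (N u \<inter> S)" "\<lambda>_. 1"] by simp
  qed
  finally have in_S: "(\<Sum>w\<in>S. card (I w)) \<le> (\<Sum>u\<in>S. card (N u \<inter> S)) + card (A - S)"
    by simp
  have inner: "2 * (\<Sum>u\<in>S. card (N u \<inter> S)) \<le> card S * (card S - 1)"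
  proof -
    have "card (N u \<inter> S) + card (I u \<inter> S) \<le> card S - 1" if "u \<in> S" for u
    proof -
      have "(N u \<inter> S) \<inter> (I u \<inter> S) = {}"
        using arc_asym by auto
      then have "card (N u \<inter> S) + card (I u \<inter> S) = card ((N u \<inter> S) \<union> (I u \<inter> S))"
        by (intro card_Un_disjoint[symmetric]) auto
      also have "\<dots> \<le> card (S - {u})"
        using fin(2) arc_irrefl by (intro card_mono) auto
      finally show ?thesis
        using that by simp
    qed
    then have "(\<Sum>u\<in>S. card (N u \<inter> S) + card (I u \<inter> S)) \<le> (\<Sum>u\<in>S. card S - 1)"
      by (rule sum_mono)
    then show ?thesis
      using arc_count[OF fin(2,2)] by (simp add: sum.distrib)
  qed
  have "(\<Sum>w\<in>S. card (I w) + 3 + e w + sz w) = (\<Sum>w\<in>S. 9)"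
    using card_I n fin(4) by (intro sum.cong) auto
  then have in_total: "(\<Sum>w\<in>S. card (I w)) + 3 * card S + 3 + (\<Sum>w\<in>S. sz w) = 9 * card S"
    using sum_S by (simp add: sum.distrib)
  have sz_S: "(\<Sum>w\<in>S. sz w) = 2 * card S + card (A \<inter> S)"
  proof -
    have "sz w = 2 + of_bool (w \<in> A)" if "w \<in> S" for w
    proof -
      have "w \<in> V"
        using that fin(4) by blast
      then show ?thesis
        using sz[of w] by (auto simp: A_def)
    qed
    then have "(\<Sum>w\<in>S. sz w) = (\<Sum>w\<in>S. 2 + of_bool (w \<in> A))"
      by (intro sum.cong) simp_all
    also have "\<dots> = (\<Sum>w\<in>S. 2) + (\<Sum>w\<in>S. of_bool (w \<in> A))"
      by (rule sum.distrib)
    also have "(\<Sum>w\<in>S. of_bool (w \<in> A)) = card (A \<inter> S)"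
      using fin(2) by (simp add: Int_commute)
    finally show ?thesis
      by simp
  qed
  have "card (A - S) + card (A \<inter> S) = 3"
    using card_Diff_subset_Int[of A S] card_mono[of A "A \<inter> S"] fin \<open>card A = 3\<close> by simp
  \<comment> \<open>The arcs into \<open>S\<close> number
    \<open>4 * card S - 3 - card (A \<inter> S)\<close>, and at most \<open>card (A - S)\<close>
    plus half of \<open>card S * (card S - 1)\<close>. Doubling gives a bound that fails for 2 and
    3.\<close>
  then have key: "8 * card S \<le> 12 + card S * (card S - 1)"
    using in_S inner in_total sz_S by linarith
  have "card S \<le> 3"
    using sum_S sum_mono[of S "\<lambda>_. 1" e] by (auto simp: S_def)
  moreover have "card S \<noteq> 0"
    using sum_S fin(2) by auto
  moreover have "card S \<noteq> 2" "card S \<noteq> 3"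
    using key by auto
  ultimately have "card S = 1"
    by linarith
  then obtain w where w: "S = {w}"
    using card_1_singletonE by blast
  then have "w \<in> V" "e w = 3"
    using sum_S fin(4) by simp_all
  moreover have "e v = 0" if "v \<in> V" "v \<noteq> w" for v
  proof -
    have "v \<notin> S"
      using w that(2) by simp
    then show ?thesis
      using that(1) by (simp add: S_def)
  qed
  moreover have "card {v \<in> V. sz v = 2} \<noteq> 0"
    using q(2)[of 2] q_val by simp
  then have "{v \<in> V. sz v = 2} \<noteq> {}"
    by (metis card.empty)
  ultimately show False
    using single_exceeding_4_9[OF k n sz] by blast
qed

section \<open>Three parts\<close>

lemma colors_3:
  assumes "k = 3" "{i, j, l} \<subseteq> c ` V" "i \<noteq> j" "i \<noteq> l" "j \<noteq> l"
  shows "c ` V = {i, j, l}"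
  using assms card_parts finite_V by (intro card_subset_eq[symmetric]) auto

text \<open>A walk \<open>w\<close>, \<open>x\<close>, \<open>y\<close>, \<open>t\<close> inside
  \<open>N u\<close> alternates between the two remaining colours, and asymmetry separates
  \<open>w\<close> from \<open>y\<close> and \<open>x\<close> from \<open>t\<close>; so each colour
  occurs twice.\<close>

lemma N_parts:
  assumes "k = 3" "u \<in> V" "{c u, j, l} \<subseteq> c ` V" "c u \<noteq> j" "c u \<noteq> l" "j \<noteq> l"
  shows "2 \<le> card (N u \<inter> P j)" "d u = card (N u \<inter> P j) + card (N u \<inter> P l)"
proof -
  have colors: "c v = j \<or> c v = l" if "v \<in> N u" for v
  proof -
    have "c v \<in> c ` V" "c v \<noteq> c u"
      using that arc_color[of u v] arc_in_V[of u v] by auto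
    then show ?thesis
      using colors_3[OF assms(1,3-6)] by simp
  qed
  obtain w where "w \<in> N u"
    using N_nonempty[OF assms(2)] by blast
  obtain x y t where step: "R w x" "R x y" "R y t" "x \<in> N u" "y \<in> N u" "t \<in> N u"
    using out_step \<open>w \<in> N u\<close> mem_N by metis
  have ne: "w \<noteq> y" "x \<noteq> t"
    using step arc_asym by blast+
  have "c y = c w" "c t = c x" "c x \<noteq> c w"
    using colors[OF \<open>w \<in> N u\<close>] colors[OF step(4)] colors[OF step(5)] colors[OF step(6)]
      arc_color[OF step(1)] arc_color[OF step(2)] arc_color[OF step(3)] by auto
  then have "{w, y} \<subseteq> N u \<inter> P j \<or> {x, t} \<subseteq> N u \<inter> P j"
    using colors[OF \<open>w \<in> N u\<close>] colors[OF step(4)] step(4-6) \<open>w \<in> N u\<close> arc_in_V[of u] by auto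
  then show "2 \<le> card (N u \<inter> P j)"
    using ne card_mono[of "N u \<inter> P j" "{w, y}"] card_mono[of "N u \<inter> P j" "{x, t}"] by auto
  have "v \<in> P j \<union> P l" if "v \<in> N u" for v
    using colors[OF that] that N_sub[of u] by auto
  then have "N u = (N u \<inter> P j) \<union> (N u \<inter> P l)"
    by blast
  moreover have "card ((N u \<inter> P j) \<union> (N u \<inter> P l)) = card (N u \<inter> P j) + card (N u \<inter> P l)"
    using assms(6) by (intro card_Un_disjoint) auto
  ultimately show "d u = card (N u \<inter> P j) + card (N u \<inter> P l)"
    by (simp add: d_def)
qed

lemma other_colors:
  assumes "k = 3" "i \<in> c ` V"
  obtains j l where "c ` V = {i, j, l}" "i \<noteq> j" "i \<noteq> l" "j \<noteq> l"
proof -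
  have "card (c ` V - {i}) = 2"
    using assms card_parts finite_V by simp
  then obtain j l where "c ` V - {i} = {j, l}" "j \<noteq> l"
    by (meson card_2_iff)
  then have "c ` V = {i, j, l}" "i \<noteq> j" "i \<noteq> l"
    using assms(2) by blast+
  then show thesis
    using that \<open>j \<noteq> l\<close> by blast
qed

lemma d_ge_4:
  assumes "k = 3" "u \<in> V"
  shows "4 \<le> d u"
proof -
  obtain j l where jl: "c ` V = {c u, j, l}" "c u \<noteq> j" "c u \<noteq> l" "j \<noteq> l"
    using other_colors[OF assms(1), of "c u"] assms(2) by blast
  then show ?thesis
    using N_parts[OF assms, of j l] N_parts[OF assms, of l j] by auto
qed

text \<open>Out-degrees of at least 4 make \<open>8 * card V\<close> plus the sum of squares of the
  part sizes at most \<open>card V * card V\<close>, and that sum is at least a third of the latter.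
  So 12 is the minimum, and equality makes all parts equal and all out-degrees 4.\<close>

lemma balanced_3:
  assumes "k = 3" "card V \<le> 12"
  shows "card V = 12" "v \<in> V \<Longrightarrow> d v = 4" "v \<in> V \<Longrightarrow> sz v = 4"
proof -
  have "V \<noteq> {}"
    using assms card_V_ge_7 by auto
  then obtain i where "i \<in> c ` V"
    by blast
  then obtain j l where col: "c ` V = {i, j, l}" "i \<noteq> j" "i \<noteq> l" "j \<noteq> l"
    using other_colors[OF assms(1)] by blast
  define p q r where "p = card (P i)" and "q = card (P j)" and "r = card (P l)"
  have V: "V = P i \<union> (P j \<union> P l)"
    using col(1) by auto
  have disj: "P i \<inter> (P j \<union> P l) = {}" "P j \<inter> P l = {}"
    using col by auto
  have sum_V: "(\<Sum>v\<in>V. f v) = (\<Sum>v\<in>P i. f v) + ((\<Sum>v\<in>P j. f v) + (\<Sum>v\<in>P l. f v))"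
    for f :: "'a \<Rightarrow> nat"
    by (subst V) (simp add: sum.union_disjoint disj)
  have n: "card V = p + q + r"
    using sum_V[of "\<lambda>_. 1"] by (simp add: p_def q_def r_def)
  have sum_sz: "(\<Sum>v\<in>V. sz v) = p * p + q * q + r * r"
    unfolding sum_V by (simp add: sz_def p_def q_def r_def)
  have "(\<Sum>v\<in>V. 4) \<le> (\<Sum>v\<in>V. d v)"
    using d_ge_4[OF assms(1)] by (intro sum_mono)
  then have d_sum: "4 * card V \<le> (\<Sum>v\<in>V. d v)"
    by simp
  have Q: "card V * card V \<le> 3 * (p * p + q * q + r * r)"
  proof -
    have "0 \<le> (int p - q)\<^sup>2 + (int q - r)\<^sup>2 + (int p - r)\<^sup>2"
      by simp
    then have "int (card V * card V) \<le> int (3 * (p * p + q * q + r * r))"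
      unfolding n by (simp add: power2_eq_square algebra_simps)
    then show ?thesis
      by linarith
  qed
  \<comment> \<open>Stated over variables in place of the products, so that it is linear.\<close>
  have "24 * m \<le> 2 * Q" if "Q \<le> 3 * S" "2 * D + S = Q" "4 * m \<le> D" for m Q S D :: nat
    using that by linarith
  from this[OF Q sum_d_sz[unfolded sum_sz] d_sum]
  have "24 * card V \<le> 2 * (card V * card V)" .
  then show n_12: "card V = 12"
    using assms(2) \<open>V \<noteq> {}\<close> finite_V card_gt_0_iff[of V] by simp
  have sums: "p * p + q * q + r * r = 48" "(\<Sum>v\<in>V. d v) = 48"
    using sum_d_sz d_sum Q unfolding sum_sz n_12 by simp_all
  \<comment> \<open>The squared differences measure the defect in the inequality \<open>Q\<close>,
    here 3 * 48 - 144 = 0.\<close>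
  have "(int p - q)\<^sup>2 + (int q - r)\<^sup>2 + (int p - r)\<^sup>2
      = 3 * int (p * p + q * q + r * r) - (int (p + q + r))\<^sup>2"
    by (simp add: power2_eq_square algebra_simps)
  also have "\<dots> = 0"
    using sums(1) n n_12 by simp
  finally have "(int p - q)\<^sup>2 + (int q - r)\<^sup>2 = 0"
    using zero_le_power2[of "int p - q"] zero_le_power2[of "int q - r"] zero_le_power2[of "int p - r"]
    by linarith
  then have "p = 4" "q = 4" "r = 4"
    using n n_12 by (simp_all add: sum_power2_eq_zero_iff)
  then show "sz v = 4" if "v \<in> V"
    using that col(1) by (auto simp: sz_def p_def q_def r_def)
  show "d v = 4" if "v \<in> V"
  proof -
    have "(\<Sum>v\<in>V. d v - 4) = 0"
      using sums(2) n_12 d_ge_4[OF assms(1)] by (subst sum_subtractf_nat) auto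
    then show ?thesis
      using that finite_V d_ge_4[OF assms(1) that] by (fastforce intro: le_antisym)
  qed
qed

end

section \<open>Twins in the balanced tripartite case\<close>

locale balanced_tripartite = competing_tournament V R c k
  for V :: "'a set" and R and c :: "'a \<Rightarrow> 'c" and k +
  assumes k_eq: "k = 3" and card_12: "card V = 12"
    and d_4: "v \<in> V \<Longrightarrow> d v = 4" and sz_4: "v \<in> V \<Longrightarrow> sz v = 4"
begin

sublocale competing_tournament_3
  by unfold_locales (simp add: k_eq)

definition three_parts :: "'c \<Rightarrow> 'c \<Rightarrow> 'c \<Rightarrow> bool" where
  "three_parts i j l \<longleftrightarrow> c ` V = {i, j, l} \<and> i \<noteq> j \<and> i \<noteq> l \<and> j \<noteq> l"

lemma three_parts_perm:
  "three_parts i j l \<Longrightarrow> three_parts i l j" "three_parts i j l \<Longrightarrow> three_parts j i l" "three_parts i j l \<Longrightarrow> three_parts l i j"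
  unfolding three_parts_def by auto

lemma card_P: "i \<in> c ` V \<Longrightarrow> card (P i) = 4"
  using sz_4 by (auto simp: sz_def)

text \<open>By \<open>N_parts\<close> each of the two other parts receives at least 2 of the 4
  out-neighbours.\<close>

lemma card_N_P:
  assumes "three_parts i j l" "u \<in> P i"
  shows "card (N u \<inter> P j) = 2"
  using N_parts[OF k_eq, of u j l] N_parts[OF k_eq, of u l j] assms d_4[of u]
  unfolding three_parts_def by (auto simp: insert_commute)

lemma N_I_P:
  assumes "three_parts i j l" "u \<in> P i"
  shows "P j - N u = I u \<inter> P j" "P j - I u = N u \<inter> P j" "card (I u \<inter> P j) = 2"
proof -
  have "R u v \<noteq> R v u" if "v \<in> P j" for v
    using assms that arc_iff[of u v] arc_asym[of u v] arc_asym[of v u] unfolding three_parts_def by auto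
  then show *: "P j - N u = I u \<inter> P j" "P j - I u = N u \<inter> P j"
    by auto
  have "card (P j - N u) = card (P j) - card (N u \<inter> P j)"
    by (simp add: card_Diff_subset_Int Int_commute)
  then show "card (I u \<inter> P j) = 2"
    using card_N_P[OF assms] card_P[of j] assms(1) * unfolding three_parts_def by simp
qed

text \<open>Arcs from \<open>P l\<close> into \<open>N y\<close> end in the two vertices of
  \<open>N y \<inter> P i\<close>, each with two in-neighbours in \<open>P l\<close>. These 4 arcs
  are spread over the 4 vertices of \<open>P l\<close>, each sending at least one.\<close>

lemma codegree_1:
  assumes "three_parts i j l" "y \<in> P j" "z \<in> P l"
  shows "card (N y \<inter> N z) = 1"
proof -
  have y: "y \<in> V" "three_parts j i l"
    using assms(2) three_parts_perm(2)[OF assms(1)] by simp_all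
  have "(\<Sum>v\<in>P l. card (N v \<inter> N y)) = (\<Sum>w\<in>N y. card (I w \<inter> P l))"
    by (rule arc_count) simp_all
  also have "\<dots> = (\<Sum>w\<in>N y \<inter> P i. card (I w \<inter> P l))"
  proof (rule sum.mono_neutral_right)
    show "\<forall>w\<in>N y - N y \<inter> P i. card (I w \<inter> P l) = 0"
    proof
      fix w assume w: "w \<in> N y - N y \<inter> P i"
      then have "c w \<in> c ` V" "c w \<noteq> j" "c w \<noteq> i"
        using arc_color[of y w] arc_in_V[of y w] assms(2) by auto
      then have "c w = l"
        using y(2) unfolding three_parts_def by auto
      then show "card (I w \<inter> P l) = 0"
        using arc_color[of _ w] by auto
    qed
  qed auto
  also have "\<dots> = (\<Sum>w\<in>N y \<inter> P i. 2)"
    using N_I_P(3)[OF three_parts_perm(1)[OF assms(1)]] by (intro sum.cong) auto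
  also have "\<dots> = 4"
    using card_N_P[OF y(2) assms(2)] by simp
  finally have total: "(\<Sum>v\<in>P l. card (N v \<inter> N y)) = 4" .
  have pos: "1 \<le> card (N v \<inter> N y)" if "v \<in> P l" for v
    using codegree_pos[of v y] that y assms(2) unfolding three_parts_def by auto
  have "(\<Sum>v\<in>P l. card (N v \<inter> N y) - 1) = 0"
    using total pos card_P[of l] assms(1) unfolding three_parts_def by (subst sum_subtractf_nat) auto
  then have "card (N z \<inter> N y) - 1 = 0"
    using assms(3) by simp
  then show ?thesis
    using pos[OF assms(3)] by (simp add: Int_commute)
qed

definition twins :: "'c \<Rightarrow> 'c \<Rightarrow> bool" where
  "twins i j \<longleftrightarrow> (\<exists>x\<in>P i. \<exists>x'\<in>P i. x \<noteq> x' \<and> N x \<inter> P j = N x' \<inter> P j)"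

lemma I_twins:
  assumes "three_parts i j l" "{x, x'} \<subseteq> P i" "x \<noteq> x'" "N x \<inter> P j = N x' \<inter> P j" "y \<in> N x \<inter> P j"
  shows "I y \<inter> P i = {x, x'}"
proof -
  have "{x, x'} \<subseteq> I y \<inter> P i"
    using assms by auto
  moreover have "card (I y \<inter> P i) = 2"
    using N_I_P(3)[OF three_parts_perm(2)[OF assms(1)]] assms(5) by simp
  ultimately show ?thesis
    using assms(3) by (intro card_subset_eq[symmetric]) auto
qed

text \<open>The twins \<open>x\<close>, \<open>x'\<close> are all the in-neighbours in
  \<open>P i\<close> of each of their two out-neighbours in \<open>P j\<close>; these two therefore
  dominate the same vertices of \<open>P i\<close>, namely the other two.\<close>

lemma twins_sym:
  assumes "three_parts i j l" "twins i j"
  shows "twins j i"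
proof -
  obtain x x' where x: "{x, x'} \<subseteq> P i" "x \<noteq> x'" "N x \<inter> P j = N x' \<inter> P j"
    using assms(2) unfolding twins_def by blast
  then have "card (N x \<inter> P j) = 2"
    using card_N_P[OF assms(1)] by simp
  then obtain y y' where y: "N x \<inter> P j = {y, y'}" "y \<noteq> y'"
    by (meson card_2_iff)
  have "I y \<inter> P i = I y' \<inter> P i" "y \<in> P j" "y' \<in> P j"
    using I_twins[OF assms(1) x] y by auto
  moreover have "N v \<inter> P i = P i - (I v \<inter> P i)" if "v \<in> P j" for v
    using N_I_P(2)[OF three_parts_perm(2)[OF assms(1)] that] by blast
  ultimately have "N y \<inter> P i = N y' \<inter> P i"
    by simp
  then show ?thesis
    using y mem_N unfolding twins_def by blast
qed

text \<open>By \<open>I_twins\<close> no vertex of \<open>P i\<close> other than the twins has an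
  arc to an out-neighbour of theirs in \<open>P j\<close>.\<close>

lemma twins_disjoint:
  assumes "three_parts i j l" "{x, x'} \<subseteq> P i" "x \<noteq> x'" "N x \<inter> P j = N x' \<inter> P j"
    and "v \<in> {x, x'}" "v' \<in> P i - {x, x'}"
  shows "N v \<inter> N v' \<inter> P j = {}"
proof -
  have "\<not> R v' y" if "y \<in> N x \<inter> P j" for y
  proof -
    have "v' \<notin> I y \<inter> P i"
      using I_twins[OF assms(1-4) that] assms(6) by simp
    then show ?thesis
      using assms(6) by simp
  qed
  moreover have "N v \<inter> P j = N x \<inter> P j"
    using assms(4,5) by (metis empty_iff insert_iff)
  ultimately show ?thesis
    by (metis (no_types, lifting) Int_iff equals0I mem_N)
qed

text \<open>Otherwise some two vertices of \<open>P i\<close> are separated both by the twin pair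
  for \<open>j\<close> and by the one for \<open>l\<close>, and have no common out-neighbour in
  either part.\<close>

lemma not_both_twins:
  assumes "three_parts i j l" "twins i j"
  shows "\<not> twins i l"
proof
  assume "twins i l"
  then obtain z z' where z: "{z, z'} \<subseteq> P i" "z \<noteq> z'" "N z \<inter> P l = N z' \<inter> P l"
    unfolding twins_def by blast
  obtain x x' where x: "{x, x'} \<subseteq> P i" "x \<noteq> x'" "N x \<inter> P j = N x' \<inter> P j"
    using assms(2) unfolding twins_def by blast
  \<comment> \<open>Two pairs in a set of four: if they coincide take a vertex inside and one
    outside, otherwise one from each difference.\<close>
  obtain v v' where v: "v \<in> {x, x'}" "v' \<in> P i - {x, x'}"
    "v \<in> {z, z'} \<and> v' \<in> P i - {z, z'} \<or> v' \<in> {z, z'} \<and> v \<in> P i - {z, z'}"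
  proof (cases "{z, z'} = {x, x'}")
    case True
    have "\<not> P i \<subseteq> {x, x'}"
      using card_P[of i] assms(1) card_mono[of "{x, x'}" "P i"] x(2) unfolding three_parts_def by auto
    then obtain b where "b \<in> P i - {x, x'}"
      by blast
    then show thesis
      using x(1) True by (intro that[of x b]) simp_all
  next
    case False
    have "card {z, z'} = card {x, x'}"
      using x(2) z(2) by simp
    then have "\<not> {x, x'} \<subseteq> {z, z'}" "\<not> {z, z'} \<subseteq> {x, x'}"
      using False card_subset_eq[of "{z, z'}" "{x, x'}"] card_subset_eq[of "{x, x'}" "{z, z'}"] by auto
    then obtain a b where "a \<in> {x, x'} - {z, z'}" "b \<in> {z, z'} - {x, x'}"
      by blast
    moreover from this have "a \<in> P i" "b \<in> P i"
      using x(1) z(1) by blast+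
    ultimately show thesis
      by (intro that[of a b]) simp_all
  qed
  have "N v \<inter> N v' \<inter> P j = {}"
    using twins_disjoint[OF assms(1) x v(1,2)] .
  moreover have "N v \<inter> N v' \<inter> P l = {}"
    using twins_disjoint[OF three_parts_perm(1)[OF assms(1)] z] v(3) by blast
  moreover have "v \<in> P i" "v' \<in> P i" "v \<noteq> v'"
    using v x(1) by auto
  then obtain w where "R v w" "R v' w"
    using common_out[of v v'] by auto
  then have "w \<in> V" "c w \<in> c ` V" "c w \<noteq> i"
    using arc_color[of v w] arc_in_V[of v w] \<open>v \<in> P i\<close> by auto
  then have "w \<in> P j \<or> w \<in> P l"
    using assms(1) unfolding three_parts_def by auto
  ultimately show False
    using \<open>R v w\<close> \<open>R v' w\<close> by auto
qed

text \<open>Since \<open>x\<close> and \<open>x'\<close> share \<open>y\<close>, their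
  out-neighbours miss some \<open>y0\<close> in \<open>P j\<close>, which dominates both. By
  \<open>codegree_1\<close> no vertex of \<open>P l\<close> dominates both, so their
  in-neighbourhoods in \<open>P l\<close> are disjoint pairs in a set of four.\<close>

lemma N_complement:
  assumes "three_parts i j l" "x \<in> P i" "x' \<in> P i" "y \<in> P j" "R x y" "R x' y"
    and "N x \<inter> P j \<noteq> N x' \<inter> P j"
  shows "N x' \<inter> P l = P l - N x"
proof -
  have "x \<noteq> x'"
    using assms(7) by metis
  have "\<not> P j \<subseteq> N x \<union> N x'"
  proof
    assume "P j \<subseteq> N x \<union> N x'"
    then have "P j = (N x \<inter> P j) \<union> (N x' \<inter> P j - {y})"
      using assms(4,5) by auto
    then have "card (P j) \<le> card (N x \<inter> P j) + card (N x' \<inter> P j - {y})"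
      using card_Un_le by metis
    then show False
      using card_P[of j] card_N_P[OF assms(1,2)] card_N_P[OF assms(1,3)] assms(1,4,6)
      unfolding three_parts_def by simp
  qed
  then obtain y0 where y0: "y0 \<in> P j" "y0 \<notin> N x" "y0 \<notin> N x'"
    by blast
  then have y0_arcs: "R y0 x" "R y0 x'"
    using N_I_P(1)[OF assms(1,2)] N_I_P(1)[OF assms(1,3)] by auto
  have "\<not> (R z x \<and> R z x')" if "z \<in> P l" for z
  proof
    assume "R z x \<and> R z x'"
    then have "{x, x'} \<subseteq> N y0 \<inter> N z"
      using y0_arcs by simp
    then have "card {x, x'} \<le> card (N y0 \<inter> N z)"
      by (intro card_mono) auto
    then show False
      using codegree_1[OF assms(1) y0(1) that] \<open>x \<noteq> x'\<close> by simp
  qed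
  then have "I x \<inter> P l \<subseteq> P l - I x'"
    by auto
  then have "P l - N x \<subseteq> N x' \<inter> P l"
    using N_I_P(1)[OF three_parts_perm(1)[OF assms(1)] assms(2)]
      N_I_P(2)[OF three_parts_perm(1)[OF assms(1)] assms(3)] by simp
  moreover have "card (P l - N x) = card (N x' \<inter> P l)"
    using N_I_P(1,3)[OF three_parts_perm(1)[OF assms(1)] assms(2)]
      card_N_P[OF three_parts_perm(1)[OF assms(1)] assms(3)] by simp
  ultimately show ?thesis
    by (intro card_subset_eq[symmetric]) auto
qed

text \<open>Take \<open>x\<close> with out-neighbours \<open>y\<close>, \<open>y'\<close> in
  \<open>P j\<close>, and further in-neighbours \<open>x1\<close>, \<open>x2\<close> of these in
  \<open>P i\<close>. They differ, as otherwise \<open>x1\<close> would be a twin of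
  \<open>x\<close>; by \<open>N_complement\<close> both have in \<open>P l\<close> the
  out-neighbours that \<open>x\<close> lacks.\<close>

lemma some_twins:
  assumes "three_parts i j l" "\<not> twins i j"
  shows "twins i l"
proof -
  have other: "\<exists>x'\<in>P i. x' \<noteq> x \<and> R x' y" if "x \<in> P i" "y \<in> P j" for x y
  proof -
    have "card (I y \<inter> P i) = 2"
      using N_I_P(3)[OF three_parts_perm(2)[OF assms(1)] that(2)] .
    then have "\<not> I y \<inter> P i \<subseteq> {x}"
      using card_mono[of "{x}" "I y \<inter> P i"] by auto
    then show ?thesis
      by auto
  qed
  have "P i \<noteq> {}"
    using card_P[of i] assms(1) unfolding three_parts_def by auto
  then obtain x where x: "x \<in> P i"
    by blast
  have "card (N x \<inter> P j) = 2"
    using card_N_P[OF assms(1) x] .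
  then obtain y y' where y: "N x \<inter> P j = {y, y'}" "y \<noteq> y'"
    by (meson card_2_iff)
  then have y_arcs: "R x y" "R x y'" "y \<in> P j" "y' \<in> P j"
    using mem_N by blast+
  obtain x1 where x1: "x1 \<in> P i" "x1 \<noteq> x" "R x1 y"
    using other[OF x y_arcs(3)] by blast
  obtain x2 where x2: "x2 \<in> P i" "x2 \<noteq> x" "R x2 y'"
    using other[OF x y_arcs(4)] by blast
  have ne: "N x \<inter> P j \<noteq> N x1 \<inter> P j" "N x \<inter> P j \<noteq> N x2 \<inter> P j"
    using assms(2) x x1 x2 unfolding twins_def by blast+
  have "x1 \<noteq> x2"
  proof
    assume "x1 = x2"
    then have "{y, y'} \<subseteq> N x1 \<inter> P j"
      using x1 x2 y_arcs by simp
    moreover have "card (N x1 \<inter> P j) = 2"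
      using card_N_P[OF assms(1) x1(1)] .
    ultimately have "{y, y'} = N x1 \<inter> P j"
      using y(2) by (intro card_subset_eq) auto
    then show False
      using y(1) ne(1) by simp
  qed
  moreover have "N x1 \<inter> P l = N x2 \<inter> P l"
    using N_complement[OF assms(1) x x1(1) y_arcs(3,1) x1(3) ne(1)]
      N_complement[OF assms(1) x x2(1) y_arcs(4,2) x2(3) ne(2)] by simp
  ultimately show ?thesis
    using x1(1) x2(1) unfolding twins_def by blast
qed

text \<open>Being twins is a symmetric relation on the three colours, and every colour is related to
  exactly one of the other two: impossible, since three is odd.\<close>

lemma contradiction: False
proof -
  obtain v where "v \<in> V"
    using card_12 by fastforce
  then obtain j l where "three_parts (c v) j l"
    using other_colors[OF k_eq, of "c v"] unfolding three_parts_def by blast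
  then show False
    using some_twins not_both_twins twins_sym three_parts_perm by metis
qed

end

context competing_tournament_3
begin

lemma card_V_ge_13_if_k_3:
  assumes "k = 3"
  shows "13 \<le> card V"
proof (rule ccontr)
  assume "\<not> ?thesis"
  then have "card V \<le> 12"
    by simp
  then interpret balanced_tripartite V R c k
    using balanced_3 assms by unfold_locales auto
  show False
    by (rule contradiction)
qed

end

theorem theorem4p1:
  fixes k n :: nat
  assumes "k \<ge> 3" and "n \<ge> 1"
  shows "(\<exists>D :: nat pair_pre_digraph.
            multipartite_tournament k (with_proj D) \<and>
            complete_digraph n (with_proj (competition_graph (with_proj D)))) \<longleftrightarrow>
         (if k = 3 then n \<ge> 13
          else if k = 4 then n \<ge> 10
          else if k \<in> {5, 6} then n \<ge> 9
          else n \<ge> k)"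
proof
  assume "\<exists>D :: nat pair_pre_digraph. multipartite_tournament k (with_proj D) \<and>
    complete_digraph n (with_proj (competition_graph (with_proj D)))"
  then obtain V :: "nat set" and R and c :: "nat \<Rightarrow> nat set set"
    where V: "competing_tournament V R c k" "card V = n"
    using multipartite_tournament_imp_competing by blast
  interpret competing_tournament V R c k
    by (rule V(1))
  interpret competing_tournament_3 V R c k
    by unfold_locales (rule assms(1))
  \<comment> \<open>For \<open>k\<close> at least 7 the bound \<open>k \<le> n\<close> is the claim;
    for \<open>k\<close> from 4 to 6 the values of \<open>n\<close> from 7 up to the threshold are
    excluded one by one.\<close>
  have "7 \<le> n" "k \<le> n" "n = 7 \<Longrightarrow> k = 7" "n = 8 \<Longrightarrow> k \<notin> {4, 5, 6}" "n = 9 \<Longrightarrow> k \<noteq> 4"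
      "k = 3 \<Longrightarrow> 13 \<le> n"
    using card_V_ge_7 card_V_ge_k k_eq_7_if_card_7 k_ne_4_if_card_8 k_ne_5_if_card_8
      k_ne_6_if_card_8 k_ne_4_if_card_9 card_V_ge_13_if_k_3 V(2) by auto
  then show "if k = 3 then n \<ge> 13
          else if k = 4 then n \<ge> 10
          else if k \<in> {5, 6} then n \<ge> 9
          else n \<ge> k"
    by (cases "n = 7"; cases "n = 8"; cases "n = 9") auto
next
  assume "if k = 3 then n \<ge> 13
          else if k = 4 then n \<ge> 10
          else if k \<in> {5, 6} then n \<ge> 9
          else n \<ge> k"
  then have "realizable k n"
    using realizable_if_large assms(1) by simp
  then obtain V :: "nat set" and R and c :: "nat \<Rightarrow> nat"
    where "competing_tournament V R c k" "card V = n"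
    unfolding realizable_def by blast
  then show "\<exists>D :: nat pair_pre_digraph. multipartite_tournament k (with_proj D) \<and>
    complete_digraph n (with_proj (competition_graph (with_proj D)))"
    using competing_imp_multipartite_tournament by blast
qed

end
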